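(* Let $(S,\Sigma,\mu)$ be a finite positive measure space, let $(E,\mathcal{E})$ be a measurable space, let $Z$ be a Banach space with closed dual unit ball $B_*=\{z^*\in Z^*:\|z^*\|\le 1\}$, and let $\boldsymbol{m}:\mathcal{E}\to L_0(\mu,Z)$ be a countably additive vector measure. Then there exists $z_0^*\in B_*$ such that $\boldsymbol{m}\ll z_0^*\boldsymbol{m}$, i.e., for every $A\in\mathcal{E}$: if $z_0^*\boldsymbol{m}(B)=0$ in $L_0(\mu)$ for all $B\in\mathcal{E}$ with $B\subset A$, then $\boldsymbol{m}(B)=0$ in $L_0(\mu,Z)$ for all $B\in\mathcal{E}$ with $B\subset A$. In other words, any control measure for $z_0^*\boldsymbol{m}$ is also a control measure for $\boldsymbol{m}$.
   Context: A measurable space $(E,\mathcal{E})$ is a set $E$ with a $\sigma$-algebra $\mathcal{E}$ of its subsets. A function $f:S\to Z$ is Bochner measurable if some sequence of $\Sigma$-simple $Z$-valued functions converges to $f$ $\mu$-a.e. on $S$. $L_0(\mu,Z)$ is the linear space of $\mu$-equivalence classes of Bochner measurable functions $S\to Z$, equipped with the topology $\tau_\mu$ of convergence in measure $\mu$, given by the $F$-norm $\|f\|_\mu=\inf\{\varepsilon>0:\mu(\{s:\|f(s)\|\ge\varepsilon\})\le\varepsilon\}$ (if needed, $\mu$ is replaced by the associated outer measure); $L_0(\mu)=L_0(\mu,\mathbb{K})$, where $\mathbb{K}$ is the scalar field of $Z$. Countable additivity is with respect to the topology of convergence in measure. For $z^*\in Z^*$, $z^*\boldsymbol{m}:\mathcal{E}\to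 L_0(\mu)$ is the vector measure $A\mapsto z^*\circ(\boldsymbol{m}(A))$. A control measure for a vector measure $\boldsymbol{n}$ on $\mathcal{E}$ is a finite positive measure $\nu$ on $\mathcal{E}$ such that $\nu(A)=0$ implies $\boldsymbol{n}(A)=0$ for all $A\in\mathcal{E}$. *)

theory Defs
  imports "HOL-Analysis.Analysis"
begin

section \<open>Banach spaces over the real or complex numbers\<close>

text \<open>
  The scalar field is a type of sort \<open>{real_normed_field, euclidean_space}\<close>. Both \<open>real\<close> and
  \<open>complex\<close> have this sort, and up to isomorphism they are the only such types (a
  finite-dimensional commutative field extension of the reals whose norm is multiplicative).
  The class \<open>banach\<close> provides the underlying real Banach space; the locale adds multiplication
  by scalars from the field.
\<close>

locale banach_space_over = vector_space scl
  for scl :: "'k::{real_normed_field,euclidean_space} \<Rightarrow> 'z::banach \<Rightarrow> 'z" +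
  assumes norm_scale: "norm (scl c z) = norm c * norm z"
    and scale_of_real: "scl (of_real r) z = r *\<^sub>R z"

text \<open>
  A bounded linear function in the type \<open>\<Rightarrow>\<^sub>L\<close> is only real linear; the dual space consists of
  those that are linear over the scalar field. The norm of \<open>\<Rightarrow>\<^sub>L\<close> is the dual norm.
\<close>

definition dual_space ::
  "('k::{real_normed_field,euclidean_space} \<Rightarrow> 'z::banach \<Rightarrow> 'z) \<Rightarrow> ('z \<Rightarrow>\<^sub>L 'k) set"
  where "dual_space scl = {zs. \<forall>c z. blinfun_apply zs (scl c z) = c * blinfun_apply zs z}"

definition dual_ball ::
  "('k::{real_normed_field,euclidean_space} \<Rightarrow> 'z::banach \<Rightarrow> 'z) \<Rightarrow> ('z \<Rightarrow>\<^sub>L 'k) set"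
  where "dual_ball scl = {zs \<in> dual_space scl. norm zs \<le> 1}"

lemma banach_space_over_real: "banach_space_over (scaleR :: real \<Rightarrow> 'z::banach \<Rightarrow> 'z)"
  by unfold_locales (simp_all add: algebra_simps)

lemma banach_space_over_complex: "banach_space_over ((*) :: complex \<Rightarrow> complex \<Rightarrow> complex)"
  by unfold_locales (simp_all add: algebra_simps norm_mult scaleR_conv_of_real)


section \<open>The space of classes of Bochner measurable functions\<close>

definition bochner_measurable :: "'s measure \<Rightarrow> ('s \<Rightarrow> 'z::real_normed_vector) \<Rightarrow> bool"
  where "bochner_measurable M f \<longleftrightarrow>
    (\<exists>g. (\<forall>n. simple_function M (g n)) \<and> (AE s in M. (\<lambda>n. g n s) \<longlonglongrightarrow> f s))"

text \<open>
  Functions are total on the type \<open>'s\<close>; their values outside \<open>space M\<close> are ignored by \<open>AE\<close> and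
  hence by the classes.
\<close>

definition L0_class ::
  "'s measure \<Rightarrow> ('s \<Rightarrow> 'z::real_normed_vector) \<Rightarrow> ('s \<Rightarrow> 'z) set"
  where "L0_class M f = {g. bochner_measurable M g \<and> (AE s in M. f s = g s)}"

definition L0 :: "'s measure \<Rightarrow> ('s \<Rightarrow> 'z::real_normed_vector) set set"
  where "L0 M = L0_class M ` {f. bochner_measurable M f}"

definition L0_zero :: "'s measure \<Rightarrow> ('s \<Rightarrow> 'z::real_normed_vector) set"
  where "L0_zero M = L0_class M (\<lambda>_. 0)"

definition L0_plus :: "'s measure \<Rightarrow> ('s \<Rightarrow> 'z::real_normed_vector) set \<Rightarrow> ('s \<Rightarrow> 'z) set \<Rightarrow> ('s \<Rightarrow> 'z) set"
  where "L0_plus M X Y = (\<Union>f\<in>X. \<Union>g\<in>Y. L0_class M (\<lambda>s. f s + g s))"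

definition L0_minus :: "'s measure \<Rightarrow> ('s \<Rightarrow> 'z::real_normed_vector) set \<Rightarrow> ('s \<Rightarrow> 'z) set \<Rightarrow> ('s \<Rightarrow> 'z) set"
  where "L0_minus M X Y = (\<Union>f\<in>X. \<Union>g\<in>Y. L0_class M (\<lambda>s. f s - g s))"

definition L0_comp ::
  "'s measure \<Rightarrow> ('z::real_normed_vector \<Rightarrow> 'k::real_normed_vector) \<Rightarrow> ('s \<Rightarrow> 'z) set \<Rightarrow> ('s \<Rightarrow> 'k) set"
  where "L0_comp M h X = (\<Union>f\<in>X. L0_class M (\<lambda>s. h (f s)))"

text \<open>
  The F-norm of convergence in measure. A Bochner measurable function is measurable only up to
  a null set, so that the outer measure is needed when \<open>M\<close> is not complete.
\<close>

definition fnorm :: "'s measure \<Rightarrow> ('s \<Rightarrow> 'z::real_normed_vector) \<Rightarrow> real"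
  where "fnorm M f =
    Inf {\<epsilon>. 0 < \<epsilon> \<and> outer_measure_of M {s \<in> space M. norm (f s) \<ge> \<epsilon>} \<le> ennreal \<epsilon>}"

definition L0_norm :: "'s measure \<Rightarrow> ('s \<Rightarrow> 'z::real_normed_vector) set \<Rightarrow> real"
  where "L0_norm M X = the_elem (fnorm M ` X)"


subsection \<open>The operations are well defined on classes\<close>

lemma bochner_measurable_comp2:
  assumes f: "bochner_measurable M f" and g: "bochner_measurable M g"
    and h: "continuous_on UNIV (\<lambda>p. h (fst p) (snd p))"
  shows "bochner_measurable M (\<lambda>s. h (f s) (g s))"
proof -
  obtain u where u: "\<And>n. simple_function M (u n)" "AE s in M. (\<lambda>n. u n s) \<longlonglongrightarrow> f s"
    using f unfolding bochner_measurable_def by auto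
  obtain v where v: "\<And>n. simple_function M (v n)" "AE s in M. (\<lambda>n. v n s) \<longlonglongrightarrow> g s"
    using g unfolding bochner_measurable_def by auto
  have "AE s in M. (\<lambda>n. h (u n s) (v n s)) \<longlonglongrightarrow> h (f s) (g s)"
    using u(2) v(2)
  proof eventually_elim
    case (elim s)
    have "(\<lambda>n. (u n s, v n s)) \<longlonglongrightarrow> (f s, g s)"
      using elim by (rule tendsto_Pair)
    moreover have "isCont (\<lambda>p. h (fst p) (snd p)) (f s, g s)"
      using h by (simp add: continuous_on_eq_continuous_at)
    ultimately show ?case
      using isCont_tendsto_compose[of "(f s, g s)" "\<lambda>p. h (fst p) (snd p)"] by fastforce
  qed
  then show ?thesis
    unfolding bochner_measurable_def
    using simple_function_compose2[OF u(1) v(1)]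
    by (intro exI[of _ "\<lambda>n s. h (u n s) (v n s)"]) auto
qed

lemma bochner_measurable_comp:
  fixes f :: "'s \<Rightarrow> 'z::real_normed_vector"
  assumes "bochner_measurable M f" and "continuous_on UNIV h"
  shows "bochner_measurable M (\<lambda>s. h (f s))"
proof -
  have "continuous_on UNIV (\<lambda>p :: 'z \<times> 'z. h (fst p))"
    by (rule continuous_on_compose2[OF assms(2)]) (auto intro: continuous_intros)
  then show ?thesis
    using bochner_measurable_comp2[OF assms(1) assms(1), of "\<lambda>x y. h x"] by simp
qed

lemma bochner_measurable_zero: "bochner_measurable M (\<lambda>_. 0)"
  unfolding bochner_measurable_def by (intro exI[of _ "\<lambda>n s. 0"]) auto

lemma L0_class_self: "bochner_measurable M f \<Longrightarrow> f \<in> L0_class M f"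
  by (simp add: L0_class_def)

lemma L0_class_cong: "AE s in M. f s = g s \<Longrightarrow> L0_class M f = L0_class M g"
proof -
  assume eq: "AE s in M. f s = g s"
  have "(AE s in M. f s = u s) \<longleftrightarrow> (AE s in M. g s = u s)" for u
  proof
    assume "AE s in M. f s = u s"
    with eq show "AE s in M. g s = u s" by eventually_elim simp
  next
    assume "AE s in M. g s = u s"
    with eq show "AE s in M. f s = u s" by eventually_elim simp
  qed
  then show ?thesis
    by (simp add: L0_class_def)
qed

lemma L0_class_eq_iff:
  assumes "bochner_measurable M f" "bochner_measurable M g"
  shows "L0_class M f = L0_class M g \<longleftrightarrow> (AE s in M. f s = g s)"
proof
  assume "L0_class M f = L0_class M g"
  then have "g \<in> L0_class M f"
    using L0_class_self[OF assms(2)] by metis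
  then show "AE s in M. f s = g s"
    by (simp add: L0_class_def)
qed (rule L0_class_cong)

lemma L0_lift2_class:
  assumes "bochner_measurable M f" "bochner_measurable M g"
  shows "(\<Union>f'\<in>L0_class M f. \<Union>g'\<in>L0_class M g. L0_class M (\<lambda>s. h (f' s) (g' s))) =
    L0_class M (\<lambda>s. h (f s) (g s))"
proof -
  have "L0_class M (\<lambda>s. h (f' s) (g' s)) = L0_class M (\<lambda>s. h (f s) (g s))"
    if "f' \<in> L0_class M f" "g' \<in> L0_class M g" for f' g'
  proof (rule L0_class_cong)
    have "AE s in M. f s = f' s" "AE s in M. g s = g' s"
      using that by (auto simp: L0_class_def)
    then show "AE s in M. h (f' s) (g' s) = h (f s) (g s)"
      by eventually_elim simp
  qed
  moreover have "L0_class M f \<noteq> {}" "L0_class M g \<noteq> {}"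
    using assms by (auto dest: L0_class_self)
  ultimately show ?thesis
    by simp
qed

lemma L0_plus_class:
  "bochner_measurable M f \<Longrightarrow> bochner_measurable M g \<Longrightarrow>
    L0_plus M (L0_class M f) (L0_class M g) = L0_class M (\<lambda>s. f s + g s)"
  unfolding L0_plus_def by (rule L0_lift2_class)

lemma L0_minus_class:
  "bochner_measurable M f \<Longrightarrow> bochner_measurable M g \<Longrightarrow>
    L0_minus M (L0_class M f) (L0_class M g) = L0_class M (\<lambda>s. f s - g s)"
  unfolding L0_minus_def by (rule L0_lift2_class)

lemma L0_comp_class:
  assumes "bochner_measurable M f"
  shows "L0_comp M h (L0_class M f) = L0_class M (\<lambda>s. h (f s))"
proof -
  have "L0_class M (\<lambda>s. h (f' s)) = L0_class M (\<lambda>s. h (f s))" if "f' \<in> L0_class M f" for f'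
  proof (rule L0_class_cong)
    have "AE s in M. f s = f' s"
      using that by (simp add: L0_class_def)
    then show "AE s in M. h (f' s) = h (f s)"
      by eventually_elim simp
  qed
  moreover have "L0_class M f \<noteq> {}"
    using assms by (auto dest: L0_class_self)
  ultimately show ?thesis
    by (simp add: L0_comp_def)
qed

lemma outer_measure_of_AE_mono:
  assumes "AE s in M. s \<in> A \<longrightarrow> s \<in> B" "A \<subseteq> space M" "B \<subseteq> space M"
  shows "outer_measure_of M A \<le> outer_measure_of M B"
proof -
  obtain N where N: "N \<in> null_sets M" "{s \<in> space M. \<not> (s \<in> A \<longrightarrow> s \<in> B)} \<subseteq> N"
    using assms(1) by (auto simp: eventually_ae_filter)
  obtain D where D: "D \<in> sets M" "B \<subseteq> D" "outer_measure_of M B = emeasure M D"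
    using outer_measure_of_attain[OF assms(3)] by blast
  have "outer_measure_of M A \<le> outer_measure_of M (D \<union> N)"
    using N D assms(2) by (intro outer_measure_of_mono) auto
  also have "\<dots> = emeasure M D"
    using N D by (subst outer_measure_of_eq) (auto simp: emeasure_Un_null_set)
  finally show ?thesis
    using D by simp
qed

lemma fnorm_cong:
  assumes "AE s in M. f s = g s"
  shows "fnorm M f = fnorm M g"
proof -
  have "outer_measure_of M {s \<in> space M. norm (f s) \<ge> e} =
      outer_measure_of M {s \<in> space M. norm (g s) \<ge> e}" for e
  proof (intro antisym outer_measure_of_AE_mono)
    show "AE s in M. s \<in> {s \<in> space M. norm (f s) \<ge> e} \<longrightarrow> s \<in> {s \<in> space M. norm (g s) \<ge> e}"
      using assms by eventually_elim simp
    show "AE s in M. s \<in> {s \<in> space M. norm (g s) \<ge> e} \<longrightarrow> s \<in> {s \<in> space M. norm (f s) \<ge> e}"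
      using assms by eventually_elim simp
  qed auto
  then show ?thesis
    by (simp add: fnorm_def)
qed

lemma L0_norm_class:
  assumes "bochner_measurable M f"
  shows "L0_norm M (L0_class M f) = fnorm M f"
proof -
  have "fnorm M g = fnorm M f" if "g \<in> L0_class M f" for g
  proof -
    have "AE s in M. f s = g s"
      using that by (simp add: L0_class_def)
    then show ?thesis
      by (rule fnorm_cong[symmetric])
  qed
  moreover have "L0_class M f \<noteq> {}"
    using assms by (auto dest: L0_class_self)
  ultimately have "fnorm M ` L0_class M f = {fnorm M f}"
    by (simp add: image_constant_conv cong: image_cong)
  then show ?thesis
    by (simp add: L0_norm_def)
qed


section \<open>Vector measures with values in the space of measurable functions\<close>

primrec L0_partial_sum ::
  "'s measure \<Rightarrow> (nat \<Rightarrow> ('s \<Rightarrow> 'z::real_normed_vector) set) \<Rightarrow> nat \<Rightarrow> ('s \<Rightarrow> 'z) set"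
  where
    "L0_partial_sum M X 0 = L0_zero M"
  | "L0_partial_sum M X (Suc n) = L0_plus M (L0_partial_sum M X n) (X n)"

definition L0_sums ::
  "'s measure \<Rightarrow> (nat \<Rightarrow> ('s \<Rightarrow> 'z::real_normed_vector) set) \<Rightarrow> ('s \<Rightarrow> 'z) set \<Rightarrow> bool"
  where "L0_sums M X Y \<longleftrightarrow> (\<lambda>n. L0_norm M (L0_minus M (L0_partial_sum M X n) Y)) \<longlonglongrightarrow> 0"

text \<open>
  Finite additivity and \<open>m {} = 0\<close> need not be required separately: for the constant sequence
  \<open>{}\<close>, convergence of the series forces \<open>m {} = 0\<close>.
\<close>

definition L0_vector_measure ::
  "'e set set \<Rightarrow> 's measure \<Rightarrow> ('e set \<Rightarrow> ('s \<Rightarrow> 'z::real_normed_vector) set) \<Rightarrow> bool"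
  where "L0_vector_measure \<E> M m \<longleftrightarrow>
    m \<in> \<E> \<rightarrow> L0 M \<and>
    (\<forall>A :: nat \<Rightarrow> 'e set. range A \<subseteq> \<E> \<longrightarrow> disjoint_family A \<longrightarrow>
      L0_sums M (\<lambda>i. m (A i)) (m (\<Union>i. A i)))"

definition functional_measure ::
  "'s measure \<Rightarrow> ('z::real_normed_vector \<Rightarrow>\<^sub>L 'k::real_normed_vector) \<Rightarrow>
    ('e set \<Rightarrow> ('s \<Rightarrow> 'z) set) \<Rightarrow> 'e set \<Rightarrow> ('s \<Rightarrow> 'k) set"
  where "functional_measure M zs m = (\<lambda>A. L0_comp M (blinfun_apply zs) (m A))"

text \<open>\<open>L0_abs_cont \<E> M m n\<close> stands for \<open>m \<lless> n\<close>.\<close>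

definition L0_abs_cont ::
  "'e set set \<Rightarrow> 's measure \<Rightarrow> ('e set \<Rightarrow> ('s \<Rightarrow> 'z::real_normed_vector) set) \<Rightarrow>
    ('e set \<Rightarrow> ('s \<Rightarrow> 'k::real_normed_vector) set) \<Rightarrow> bool"
  where "L0_abs_cont \<E> M m n \<longleftrightarrow>
    (\<forall>A\<in>\<E>. (\<forall>B\<in>\<E>. B \<subseteq> A \<longrightarrow> n B = L0_zero M) \<longrightarrow> (\<forall>B\<in>\<E>. B \<subseteq> A \<longrightarrow> m B = L0_zero M))"

definition control_measure ::
  "'e set \<Rightarrow> 'e set set \<Rightarrow> 's measure \<Rightarrow> ('e set \<Rightarrow> ('s \<Rightarrow> 'z::real_normed_vector) set) \<Rightarrow>
    'e measure \<Rightarrow> bool"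
  where "control_measure \<Omega> \<E> M n \<nu> \<longleftrightarrow>
    finite_measure \<nu> \<and> space \<nu> = \<Omega> \<and> sets \<nu> = \<E> \<and>
    (\<forall>A\<in>\<E>. emeasure \<nu> A = 0 \<longrightarrow> n A = L0_zero M)"

end

theory Submission
  imports Defs
begin

text \<open>
  Call a set null for a measure if the measure vanishes on all of its measurable subsets. Disjoint sets
  have measures tending to zero, so every \<open>\<sigma>\<close>-ideal of measurable sets has a largest element modulo
  null sets; with the Hahn-Banach theorem this gives countably many functionals \<open>w\<^sub>n\<close> such that a set is
  null for \<open>m\<close> as soon as it is null for all \<open>w\<^sub>n m\<close>. By the Baire category theorem it is enough that for
  fixed \<open>w\<close> and \<open>\<epsilon>\<close> the functionals \<open>z\<close> for which some set \<open>A\<close> with \<open>\<parallel>w m(A)\<parallel> \<ge> \<epsilon>\<close> is null for \<open>z m\<close>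
  form a nowhere dense set.

  Suppose that they are dense in a ball. Fix numbers \<open>t\<^sub>0, t\<^sub>1, \<dots>\<close>, all different, and choose such
  functionals \<open>y\<^sub>k\<close> with sets \<open>A\<^sub>k\<close> one after the other so that, for each \<open>i\<close>, a subsequence converges
  to \<open>z\<^sub>i = a + t\<^sub>i w\<close>. If each distance is chosen small enough in terms of the finitely many sets
  constructed before, then the upper limit \<open>L\<^sub>i\<close> of the corresponding sets \<open>A\<^sub>k\<close> is null for \<open>z\<^sub>i m\<close> on the
  \<open>\<sigma>\<close>-algebra generated by the \<open>A\<^sub>k\<close>. On \<open>L\<^sub>i \<inter> L\<^sub>j\<close> also \<open>(t\<^sub>i - t\<^sub>j) w m\<close> vanishes, and so the \<open>L\<^sub>i\<close>
  yield infinitely many disjoint sets on which \<open>w m\<close> is at least \<open>\<epsilon>/2\<close>, which is impossible.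
  In this way no bound on the range of \<open>m\<close> and no control measure is needed.
\<close>

section \<open>Functionals separating points\<close>

definition sublinear :: "('a::real_vector \<Rightarrow> real) \<Rightarrow> bool"
  where "sublinear p \<longleftrightarrow>
    (\<forall>x y. p (x + y) \<le> p x + p y) \<and> (\<forall>t x. 0 \<le> t \<longrightarrow> p (t *\<^sub>R x) = t * p x)"

lemma sublinear_add: "sublinear p \<Longrightarrow> p (x + y) \<le> p x + p y"
  by (simp add: sublinear_def)

lemma sublinear_scale: "sublinear p \<Longrightarrow> 0 \<le> t \<Longrightarrow> p (t *\<^sub>R x) = t * p x"
  by (simp add: sublinear_def)

lemma sublinear_zero: "sublinear p \<Longrightarrow> p 0 = 0"
  using sublinear_scale[of p 0 0] by simp

lemma sublinear_minus: "sublinear p \<Longrightarrow> - p (- x) \<le> p x"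
  using sublinear_add[of p x "- x"] sublinear_zero[of p] by simp

text \<open>One inequality in \<open>scale\<close> suffices: applied to \<open>inverse t\<close> and
  \<open>t *\<^sub>R x\<close> it gives the reverse one.\<close>

lemma sublinearI:
  assumes add: "\<And>x y. p (x + y) \<le> p x + p y"
    and zero: "p 0 = 0"
    and scale: "\<And>t x. 0 < t \<Longrightarrow> p (t *\<^sub>R x) \<le> t * p x"
  shows "sublinear p"
  unfolding sublinear_def
proof (intro conjI allI impI add)
  fix t :: real and x
  assume "0 \<le> t"
  show "p (t *\<^sub>R x) = t * p x"
  proof (cases "t = 0")
    case False
    with \<open>0 \<le> t\<close> have t: "0 < t" by simp
    then have "p x \<le> inverse t * p (t *\<^sub>R x)"
      using scale[of "inverse t" "t *\<^sub>R x"] by simp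
    with t have "t * p x \<le> p (t *\<^sub>R x)"
      by (simp add: field_simps)
    with scale[OF t, of x] show ?thesis by simp
  qed (simp add: zero)
qed

text \<open>For sublinear \<open>p\<close> this is the largest sublinear function below
  \<open>p\<close> whose value at \<open>- y\<close> is at most \<open>- p y\<close>.\<close>

definition sublinear_reduct :: "('a::real_vector \<Rightarrow> real) \<Rightarrow> 'a \<Rightarrow> 'a \<Rightarrow> real"
  where "sublinear_reduct p y x = (INF t\<in>{0..}. p (x + t *\<^sub>R y) - t * p y)"

text \<open>The lower bound does not depend on \<open>t\<close>, so the infimum defining the reduct
  is finite.\<close>

lemma sublinear_reduct_lower:
  assumes "sublinear p" "0 \<le> t"
  shows "- p (- x) \<le> p (x + t *\<^sub>R y) - t * p y"
  using sublinear_add[OF assms(1), of "x + t *\<^sub>R y" "- x"] sublinear_scale[OF assms, of y] by simp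

lemma sublinear_reduct_le:
  assumes "sublinear p" "0 \<le> t"
  shows "sublinear_reduct p y x \<le> p (x + t *\<^sub>R y) - t * p y"
  unfolding sublinear_reduct_def using assms(2)
  by (intro cINF_lower bdd_belowI2[where m = "- p (- x)"] sublinear_reduct_lower assms(1)) auto

lemma sublinear_reduct_greatest:
  assumes "\<And>t. 0 \<le> t \<Longrightarrow> u \<le> p (x + t *\<^sub>R y) - t * p y"
  shows "u \<le> sublinear_reduct p y x"
  unfolding sublinear_reduct_def by (intro cINF_greatest) (use assms in auto)

text \<open>Parameters \<open>s\<close> for \<open>a\<close> and \<open>t\<close> for
  \<open>b\<close> combine to \<open>s + t\<close> for \<open>a + b\<close>, and \<open>s\<close>
  for \<open>x\<close> becomes \<open>t * s\<close> for \<open>t *\<^sub>R x\<close>.\<close>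

lemma sublinear_sublinear_reduct:
  assumes p: "sublinear p"
  shows "sublinear (sublinear_reduct p y)"
proof (rule sublinearI)
  fix a b
  have "sublinear_reduct p y (a + b) - (p (b + t *\<^sub>R y) - t * p y) \<le> p (a + s *\<^sub>R y) - s * p y"
    if st: "0 \<le> s" "0 \<le> t" for s t
  proof -
    have "sublinear_reduct p y (a + b) \<le> p (a + b + (s + t) *\<^sub>R y) - (s + t) * p y"
      using st by (intro sublinear_reduct_le p) auto
    moreover have "a + b + (s + t) *\<^sub>R y = (a + s *\<^sub>R y) + (b + t *\<^sub>R y)"
      by (simp add: algebra_simps)
    ultimately show ?thesis
      using sublinear_add[OF p, of "a + s *\<^sub>R y" "b + t *\<^sub>R y"] by (simp add: algebra_simps)
  qed
  then have "sublinear_reduct p y (a + b) - (p (b + t *\<^sub>R y) - t * p y) \<le> sublinear_reduct p y a"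
    if "0 \<le> t" for t
    using that by (intro sublinear_reduct_greatest) auto
  then have "sublinear_reduct p y (a + b) - sublinear_reduct p y a \<le> p (b + t *\<^sub>R y) - t * p y"
    if "0 \<le> t" for t
    using that by (simp add: algebra_simps)
  then have "sublinear_reduct p y (a + b) - sublinear_reduct p y a \<le> sublinear_reduct p y b"
    by (rule sublinear_reduct_greatest)
  then show "sublinear_reduct p y (a + b) \<le> sublinear_reduct p y a + sublinear_reduct p y b"
    by simp
next
  have "p (0 + t *\<^sub>R y) - t * p y = 0" if "0 \<le> t" for t
    using sublinear_scale[OF p that] by simp
  then show "sublinear_reduct p y 0 = 0"
    using sublinear_reduct_le[OF p, of 0 y 0] sublinear_reduct_greatest[of 0 p 0 y] by force
next
  fix t :: real and x
  assume t: "0 < t"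
  have "sublinear_reduct p y (t *\<^sub>R x) / t \<le> p (x + s *\<^sub>R y) - s * p y" if s: "0 \<le> s" for s
  proof -
    have "sublinear_reduct p y (t *\<^sub>R x) \<le> p (t *\<^sub>R x + (t * s) *\<^sub>R y) - (t * s) * p y"
      using s t by (intro sublinear_reduct_le p) auto
    also have "t *\<^sub>R x + (t * s) *\<^sub>R y = t *\<^sub>R (x + s *\<^sub>R y)"
      by (simp add: algebra_simps)
    also have "p (t *\<^sub>R (x + s *\<^sub>R y)) = t * p (x + s *\<^sub>R y)"
      using t by (intro sublinear_scale p) auto
    finally show ?thesis
      using t by (simp add: field_simps)
  qed
  then have "sublinear_reduct p y (t *\<^sub>R x) / t \<le> sublinear_reduct p y x"
    by (rule sublinear_reduct_greatest)
  then show "sublinear_reduct p y (t *\<^sub>R x) \<le> t * sublinear_reduct p y x"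
    using t by (simp add: field_simps)
qed

text \<open>The values at \<open>x\<close> are bounded below by \<open>- p0 (- x)\<close>.
  Subadditivity survives the infimum because in a chain two members can both be replaced by the
  smaller one.\<close>

lemma sublinear_chain_Inf:
  fixes C :: "('a::real_vector \<Rightarrow> real) set"
  assumes "C \<noteq> {}"
    and sub: "\<And>p. p \<in> C \<Longrightarrow> sublinear p \<and> p \<le> p0"
    and chain: "\<And>p q. p \<in> C \<Longrightarrow> q \<in> C \<Longrightarrow> p \<le> q \<or> q \<le> p"
  shows "sublinear (\<lambda>x. INF p\<in>C. p x)" and "\<And>p x. p \<in> C \<Longrightarrow> (INF p\<in>C. p x) \<le> p x"
proof -
  have bdd: "bdd_below ((\<lambda>p. p x) ` C)" for x
  proof (rule bdd_belowI2)
    fix p assume "p \<in> C"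
    then have "sublinear p" "p (- x) \<le> p0 (- x)"
      using sub by (auto simp: le_fun_def)
    then show "- p0 (- x) \<le> p x"
      using sublinear_minus[of p x] by simp
  qed
  show lower: "(INF p\<in>C. p x) \<le> p x" if "p \<in> C" for p x
    using that by (intro cINF_lower bdd)
  show "sublinear (\<lambda>x. INF p\<in>C. p x)"
  proof (rule sublinearI)
    fix x y
    have "(INF p\<in>C. p (x + y)) \<le> p x + q y" if pq: "p \<in> C" "q \<in> C" for p q
    proof -
      obtain r where r: "r \<in> C" "r \<le> p" "r \<le> q"
        using chain[OF pq] pq by auto
      have "(INF p\<in>C. p (x + y)) \<le> r x + r y"
        using lower[OF r(1), of "x + y"] sublinear_add[of r x y] sub[OF r(1)] by simp
      also have "\<dots> \<le> p x + q y"
        using r by (simp add: le_fun_def add_mono)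
      finally show ?thesis .
    qed
    then have "(INF p\<in>C. p (x + y)) - q y \<le> (INF p\<in>C. p x)" if "q \<in> C" for q
      using assms(1) that by (intro cINF_greatest) (auto simp: algebra_simps)
    then have "(INF p\<in>C. p (x + y)) - (INF p\<in>C. p x) \<le> (INF p\<in>C. p y)"
      using assms(1) by (intro cINF_greatest) (auto simp: algebra_simps)
    then show "(INF p\<in>C. p (x + y)) \<le> (INF p\<in>C. p x) + (INF p\<in>C. p y)"
      by simp
  next
    have "(\<lambda>p. p 0) ` C = {0}"
      using assms(1) sub sublinear_zero by force
    then show "(INF p\<in>C. p 0) = 0" by simp
  next
    fix t :: real and x
    assume t: "0 < t"
    have "(INF p\<in>C. p (t *\<^sub>R x)) / t \<le> p x" if "p \<in> C" for p
      using lower[OF that, of "t *\<^sub>R x"] sublinear_scale[of p t x] sub[OF that] t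
      by (simp add: field_simps)
    then have "(INF p\<in>C. p (t *\<^sub>R x)) / t \<le> (INF p\<in>C. p x)"
      using assms(1) by (intro cINF_greatest)
    then show "(INF p\<in>C. p (t *\<^sub>R x)) \<le> t * (INF p\<in>C. p x)"
      using t by (simp add: field_simps)
  qed
qed

text \<open>A minimal sublinear function coincides with all its reducts and is therefore linear.\<close>

lemma sublinear_dominates_linear:
  fixes p0 :: "'a::real_vector \<Rightarrow> real"
  assumes p0: "sublinear p0"
  obtains u where "linear u" "u \<le> p0"
proof -
  define A where "A = {p. sublinear p \<and> p \<le> p0}"
  \<comment> \<open>The order is reversed: Zorn's lemma yields maximal elements, and a minimal one
    is wanted.\<close>
  define P where "P = (\<lambda>p q :: 'a \<Rightarrow> real. q \<le> p)"
  have "\<exists>m\<in>A. \<forall>a\<in>A. P m a \<longrightarrow> a = m"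
  proof (rule predicate_Zorn)
    show "partial_order_on A (relation_of P A)"
      by (rule partial_order_on_relation_ofI) (auto simp: P_def)
  next
    fix C
    assume C: "C \<in> Chains (relation_of P A)"
    then have CA: "C \<subseteq> A" and ch: "\<And>p q. p \<in> C \<Longrightarrow> q \<in> C \<Longrightarrow> p \<le> q \<or> q \<le> p"
      by (auto simp: Chains_def relation_of_def P_def)
    show "\<exists>u\<in>A. \<forall>a\<in>C. P a u"
    proof (cases "C = {}")
      case True
      with p0 show ?thesis by (auto simp: A_def)
    next
      case False
      have sub: "sublinear p \<and> p \<le> p0" if "p \<in> C" for p
        using that CA by (auto simp: A_def)
      have inf: "sublinear (\<lambda>x. INF p\<in>C. p x)" "\<And>p x. p \<in> C \<Longrightarrow> (INF p\<in>C. p x) \<le> p x"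
        by (rule sublinear_chain_Inf[of C p0]; use False sub ch in blast)+
      obtain q where "q \<in> C" using False by blast
      have "(\<lambda>x. INF p\<in>C. p x) \<le> q"
        using inf(2)[OF \<open>q \<in> C\<close>] by (simp add: le_fun_def)
      also have "q \<le> p0" using sub \<open>q \<in> C\<close> by blast
      finally have "(\<lambda>x. INF p\<in>C. p x) \<in> A"
        using inf(1) by (simp add: A_def)
      then show ?thesis
        using inf(2) by (intro bexI[of _ "\<lambda>x. INF p\<in>C. p x"]) (auto simp: P_def le_fun_def)
    qed
  qed
  then obtain u where u: "sublinear u" "u \<le> p0"
    and min: "\<And>q. sublinear q \<Longrightarrow> q \<le> u \<Longrightarrow> q = u"
    unfolding A_def P_def by (auto intro: order_trans)
  \<comment> \<open>A reduct is sublinear and, by \<open>t = 0\<close>, lies below \<open>u\<close>,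
    so minimality forces equality.\<close>
  have red: "sublinear_reduct u y = u" for y
    using sublinear_reduct_le[OF u(1), of 0 y]
    by (intro min sublinear_sublinear_reduct u(1)) (auto simp: le_fun_def)
  \<comment> \<open>With \<open>t = 1\<close>, \<open>red\<close> gives
    \<open>u x \<le> u (x + y) - u y\<close>.\<close>
  have add: "u (x + y) = u x + u y" for x y
    using sublinear_reduct_le[OF u(1), of 1 y x] sublinear_add[OF u(1), of x y] by (simp add: red)
  have neg: "u (- x) = - u x" for x
    using add[of x "- x"] sublinear_zero[OF u(1)] by simp
  have "linear u"
  proof (rule linearI)
    fix c :: real and x
    show "u (c *\<^sub>R x) = c *\<^sub>R u x"
    proof (cases "0 \<le> c")
      case False
      then have "u ((- c) *\<^sub>R x) = - c * u x"
        by (intro sublinear_scale u(1)) auto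
      then show ?thesis
        using neg[of "c *\<^sub>R x"] by simp
    qed (simp add: sublinear_scale[OF u(1)])
  qed (rule add)
  then show thesis using u(2) that by blast
qed

text \<open>A linear function below the reduct of the norm at \<open>z\<close> is bounded by the
  norm and is at most \<open>- norm z\<close> at \<open>- z\<close>, hence equals
  \<open>norm z\<close> at \<open>z\<close>.\<close>

lemma exists_norming_functional:
  fixes z :: "'a::real_normed_vector"
  obtains u where "linear u" "\<And>x. \<bar>u x\<bar> \<le> norm x" "u z = norm z"
proof -
  have sub: "sublinear (norm :: 'a \<Rightarrow> real)"
    by (rule sublinearI) (auto intro: norm_triangle_ineq)
  obtain u where u: "linear u" "u \<le> sublinear_reduct norm z"
    using sublinear_dominates_linear[OF sublinear_sublinear_reduct[OF sub]] by blast
  have le: "u x \<le> norm x" for x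
    using u(2) sublinear_reduct_le[OF sub, of 0 z x] by (auto simp: le_fun_def intro: order_trans)
  have "u (- z) \<le> - norm z"
    using u(2) sublinear_reduct_le[OF sub, of 1 z "- z"] by (auto simp: le_fun_def intro: order_trans)
  then have "u z = norm z"
    using le[of z] linear_neg[OF u(1), of z] by simp
  moreover have "\<bar>u x\<bar> \<le> norm x" for x
    using le[of x] le[of "- x"] linear_neg[OF u(1), of x] by simp
  ultimately show thesis using u(1) that by blast
qed

section \<open>Norming functionals over the scalar field\<close>

context banach_space_over
begin

text \<open>
  Fix a coordinate of the scalar field. A linear functional over the scalar field is determined by
  the real functional that is its coordinate, and every bounded real functional arises in this way.
\<close>

lemma dual_space_norming:
  obtains C where "0 < C"
    "\<And>z. \<exists>zs\<in>dual_space scl. norm zs \<le> C \<and> norm z \<le> norm (blinfun_apply zs z)"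
proof -
  obtain e :: 'k where e: "e \<in> Basis" by (meson SOME_Basis)
  define l where "l = (\<lambda>c::'k. c \<bullet> e)"
  have l: "linear l" unfolding l_def by (simp add: bounded_linear.linear bounded_linear_inner_left)
  \<comment> \<open>The coordinates of \<open>\<Phi> k\<close> are the values of the real functional
    \<open>\<lambda>c. l (c * k)\<close> on the basis, so \<open>\<Phi>\<close> turns scalars into
    real functionals on the field.\<close>
  define \<Phi> where "\<Phi> = (\<lambda>k. \<Sum>b\<in>Basis. l (b * k) *\<^sub>R b)"
  have \<Phi>_inner: "\<Phi> k \<bullet> b = l (b * k)" if "b \<in> Basis" for k b
    using that by (simp add: \<Phi>_def inner_sum_left inner_Basis if_distrib cong: if_cong)
  have lin: "linear \<Phi>"
    unfolding \<Phi>_def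
    by (rule linearI)
      (simp_all add: linear_add[OF l] linear_scale[OF l] algebra_simps sum.distrib scaleR_sum_right)
  have expand: "f c = (\<Sum>b\<in>Basis. (c \<bullet> b) * f b)" if "linear f" for f :: "'k \<Rightarrow> real" and c
  proof -
    have "f c = f (\<Sum>b\<in>Basis. (c \<bullet> b) *\<^sub>R b)" by (simp add: euclidean_representation)
    then show ?thesis by (simp add: linear_sum[OF that] linear_scale[OF that])
  qed
  have l_mult: "linear (\<lambda>c. l (c * k))" for k
    by (rule linearI) (simp_all add: linear_add[OF l] linear_scale[OF l] algebra_simps)
  \<comment> \<open>Nondegeneracy of the pairing: a nonzero \<open>j - k\<close> has an inverse in
    the field, and \<open>l e\<close> is not zero.\<close>
  have eq: "j = k" if "\<And>b. b \<in> Basis \<Longrightarrow> l (b * j) = l (b * k)" for j k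
  proof (rule ccontr)
    assume ne: "j \<noteq> k"
    have "l (c * (j - k)) = 0" for c
    proof -
      have "l (b * (j - k)) = 0" if "b \<in> Basis" for b
        using \<open>\<And>b. b \<in> Basis \<Longrightarrow> l (b * j) = l (b * k)\<close>[OF that]
        by (simp add: right_diff_distrib linear_diff[OF l])
      then show ?thesis by (subst expand[OF l_mult]) simp
    qed
    from this[of "e * inverse (j - k)"] ne have "l e = 0" by (simp add: mult.assoc)
    with e show False by (simp add: l_def)
  qed
  have "inj \<Phi>"
    by (rule injI, rule eq) (metis \<Phi>_inner)
  then obtain \<Psi> where \<Psi>: "linear \<Psi>" "\<And>c. \<Phi> (\<Psi> c) = c"
    using linear_injective_isomorphism[OF lin] by blast
  have scl_scaleR: "scl c (r *\<^sub>R x) = r *\<^sub>R scl c x" for c r x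
    by (simp flip: scale_of_real add: mult.commute)
  have scl_scaleR_left: "scl (r *\<^sub>R c) x = r *\<^sub>R scl c x" for c r x
    by (simp flip: scale_of_real scale_scale add: scaleR_conv_of_real)
  obtain K where K: "\<And>c. norm (\<Psi> c) \<le> K * norm c" "0 < K"
    using bounded_linear.pos_bounded[OF linear_conv_bounded_linear[THEN iffD1, OF \<Psi>(1)]]
    by (metis mult.commute)
  have "\<exists>zs\<in>dual_space scl. norm zs \<le> K * DIM('k) \<and> norm z \<le> norm (blinfun_apply zs z)" for z
  proof -
    obtain u where u: "linear u" "\<And>x. \<bar>u x\<bar> \<le> norm x" "u z = norm z"
      using exists_norming_functional by blast
    \<comment> \<open>\<open>\<phi> x\<close> is the scalar that represents the real functional
      \<open>\<lambda>c. u (scl c x)\<close>.\<close>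
    define \<phi> where "\<phi> = (\<lambda>x. \<Psi> (\<Sum>b\<in>Basis. u (scl b x) *\<^sub>R b))"
    have u_scl: "linear (\<lambda>c. u (scl c x))" for x
      by (rule linearI)
        (simp_all add: scale_left_distrib scl_scaleR_left linear_add[OF u(1)] linear_scale[OF u(1)])
    have \<phi>: "l (c * \<phi> x) = u (scl c x)" for c x
    proof -
      have "l (b * \<phi> x) = u (scl b x)" if "b \<in> Basis" for b
        using \<Phi>_inner[OF that, of "\<phi> x"] that unfolding \<phi>_def \<Psi>(2)
        by (simp add: inner_sum_left inner_Basis if_distrib cong: if_cong)
      then show ?thesis
        by (subst expand[OF l_mult], subst expand[OF u_scl]) simp
    qed
    have linear_\<phi>: "linear \<phi>"
      by (rule linearI; rule eq)
        (simp_all add: \<phi> scale_right_distrib scl_scaleR linear_add[OF u(1)] linear_scale[OF u(1)]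
          distrib_left linear_add[OF l] linear_scale[OF l])
    \<comment> \<open>\<open>K\<close> bounds \<open>\<Psi>\<close>, and each of the
      \<open>DIM('k)\<close> coordinates is at most \<open>norm x\<close> because basis elements
      have norm 1.\<close>
    have bound: "norm (\<phi> x) \<le> K * DIM('k) * norm x" for x
    proof -
      have "norm (\<Sum>b\<in>Basis. u (scl b x) *\<^sub>R b) \<le> (\<Sum>b\<in>(Basis :: 'k set). norm x)"
        using u(2) by (intro sum_norm_le) (simp add: order_trans[OF u(2)] norm_scale)
      then have "norm (\<phi> x) \<le> K * (\<Sum>b\<in>(Basis :: 'k set). norm x)"
        unfolding \<phi>_def using K by (meson mult_left_mono less_imp_le order_trans)
      then show ?thesis by (simp add: mult_ac)
    qed
    have "bounded_linear \<phi>"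
      using bound by (intro bounded_linear_intro[where K = "K * DIM('k)"])
        (simp_all add: linear_add[OF linear_\<phi>] linear_scale[OF linear_\<phi>] mult.commute)
    then have ap: "blinfun_apply (Blinfun \<phi>) = \<phi>"
      by (rule bounded_linear_Blinfun_apply)
    have "\<phi> (scl c x) = c * \<phi> x" for c x
      by (rule eq) (simp add: \<phi> mult.assoc[symmetric])
    then have "Blinfun \<phi> \<in> dual_space scl"
      by (simp add: dual_space_def ap)
    moreover have "norm (Blinfun \<phi>) \<le> K * DIM('k)"
      using bound K(2) by (intro norm_blinfun_bound) (auto simp: ap)
    \<comment> \<open>The coordinate of \<open>\<phi> z\<close> along \<open>e\<close> is
      \<open>u z\<close>, which is \<open>norm z\<close>, and a coordinate never exceeds the
      norm.\<close>
    moreover have "norm z \<le> norm (\<phi> z)"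
      using \<phi>[of 1 z] u(3) Basis_le_norm[OF e, of "\<phi> z"] by (simp add: l_def)
    ultimately show ?thesis using ap by metis
  qed
  then show thesis
    using that[of "K * DIM('k)"] K(2) by simp
qed

end

lemma subspace_dual_space: "subspace (dual_space scl)"
  by (rule subspaceI)
    (auto simp: dual_space_def blinfun.add_left blinfun.scaleR_left algebra_simps)

lemma closed_dual_space: "closed (dual_space scl)"
proof -
  have "dual_space scl = (\<Inter>c. \<Inter>z. {zs. blinfun_apply zs (scl c z) = c * blinfun_apply zs z})"
    by (auto simp: dual_space_def)
  also have "closed \<dots>"
    by (intro closed_INT ballI closed_Collect_eq continuous_intros)
  finally show ?thesis .
qed

section \<open>Convergence in measure\<close>

text \<open>Convergence is required at every point of the space, so that norms are Borel measurable
  even when \<open>M\<close> is not complete.\<close>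

definition strongly_measurable :: "'s measure \<Rightarrow> ('s \<Rightarrow> 'a::real_normed_vector) \<Rightarrow> bool"
  where "strongly_measurable M f \<longleftrightarrow>
    (\<exists>g. (\<forall>n. simple_function M (g n)) \<and> (\<forall>s\<in>space M. (\<lambda>n. g n s) \<longlonglongrightarrow> f s))"

lemma strongly_measurable_comp2:
  assumes f: "strongly_measurable M f" and g: "strongly_measurable M g"
    and h: "continuous_on UNIV (\<lambda>p. h (fst p) (snd p))"
  shows "strongly_measurable M (\<lambda>s. h (f s) (g s))"
proof -
  obtain u where u: "\<And>n. simple_function M (u n)" "\<And>s. s \<in> space M \<Longrightarrow> (\<lambda>n. u n s) \<longlonglongrightarrow> f s"
    using f unfolding strongly_measurable_def by auto
  obtain v where v: "\<And>n. simple_function M (v n)" "\<And>s. s \<in> space M \<Longrightarrow> (\<lambda>n. v n s) \<longlonglongrightarrow> g s"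
    using g unfolding strongly_measurable_def by auto
  have "(\<lambda>n. h (u n s) (v n s)) \<longlonglongrightarrow> h (f s) (g s)" if "s \<in> space M" for s
  proof -
    have "(\<lambda>n. (u n s, v n s)) \<longlonglongrightarrow> (f s, g s)"
      using u(2) v(2) that by (intro tendsto_Pair)
    moreover have "isCont (\<lambda>p. h (fst p) (snd p)) (f s, g s)"
      using h by (simp add: continuous_on_eq_continuous_at)
    ultimately show ?thesis
      using isCont_tendsto_compose[of "(f s, g s)" "\<lambda>p. h (fst p) (snd p)"] by fastforce
  qed
  then show ?thesis
    unfolding strongly_measurable_def
    using simple_function_compose2[OF u(1) v(1)]
    by (intro exI[of _ "\<lambda>n s. h (u n s) (v n s)"]) auto
qed

lemma strongly_measurable_comp:
  fixes f :: "'s \<Rightarrow> 'a::real_normed_vector"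
  assumes "strongly_measurable M f" and "continuous_on UNIV h"
  shows "strongly_measurable M (\<lambda>s. h (f s))"
proof -
  have "continuous_on UNIV (\<lambda>p :: 'a \<times> 'a. h (fst p))"
    by (rule continuous_on_compose2[OF assms(2)]) (auto intro: continuous_intros)
  then show ?thesis
    using strongly_measurable_comp2[OF assms(1) assms(1), of "\<lambda>x y. h x"] by simp
qed

lemma strongly_measurable_add [intro]:
  "strongly_measurable M f \<Longrightarrow> strongly_measurable M g \<Longrightarrow> strongly_measurable M (\<lambda>s. f s + g s)"
  by (rule strongly_measurable_comp2[where h = "(+)"]) (auto intro!: continuous_intros)

lemma strongly_measurable_diff [intro]:
  "strongly_measurable M f \<Longrightarrow> strongly_measurable M g \<Longrightarrow> strongly_measurable M (\<lambda>s. f s - g s)"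
  by (rule strongly_measurable_comp2[where h = "(-)"]) (auto intro!: continuous_intros)

lemma strongly_measurable_blinfun [intro]:
  "strongly_measurable M f \<Longrightarrow> strongly_measurable M (\<lambda>s. blinfun_apply v (f s))"
  by (rule strongly_measurable_comp) (auto intro: continuous_intros)

lemma strongly_measurable_zero [intro, simp]: "strongly_measurable M (\<lambda>_. 0)"
  unfolding strongly_measurable_def by (intro exI[of _ "\<lambda>_ _. 0"]) auto

lemma strongly_measurable_sum [intro]:
  assumes "\<And>i. i \<in> I \<Longrightarrow> strongly_measurable M (f i)"
  shows "strongly_measurable M (\<lambda>s. \<Sum>i\<in>I. f i s)"
  using assms by (induction I rule: infinite_finite_induct) auto

lemma strongly_measurable_norm:
  assumes "strongly_measurable M f"
  shows "(\<lambda>s. norm (f s)) \<in> borel_measurable M"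
proof -
  obtain g where g: "\<And>n. simple_function M (g n)" "\<And>s. s \<in> space M \<Longrightarrow> (\<lambda>n. g n s) \<longlonglongrightarrow> f s"
    using assms unfolding strongly_measurable_def by auto
  have "(\<lambda>s. norm (g n s)) \<in> borel_measurable M" for n
    by (intro borel_measurable_simple_function simple_function_compose1[OF g(1)])
  then show ?thesis
    by (rule borel_measurable_LIMSEQ_metric[where f = "\<lambda>n s. norm (g n s)"]) (intro tendsto_norm g(2))
qed

lemma strongly_measurable_imp_bochner: "strongly_measurable M f \<Longrightarrow> bochner_measurable M f"
  unfolding strongly_measurable_def bochner_measurable_def by (meson AE_I2)

text \<open>The function and its approximants are set to zero on a measurable null set containing
  the points where convergence fails.\<close>

lemma bochner_measurable_strong_representative:
  assumes "bochner_measurable M f"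
  obtains f' where "strongly_measurable M f'" "AE s in M. f s = f' s"
proof -
  obtain g where g: "\<And>n. simple_function M (g n)" "AE s in M. (\<lambda>n. g n s) \<longlonglongrightarrow> f s"
    using assms unfolding bochner_measurable_def by auto
  obtain N where N: "N \<in> null_sets M" "{s \<in> space M. \<not> (\<lambda>n. g n s) \<longlonglongrightarrow> f s} \<subseteq> N"
    using g(2) by (auto simp: eventually_ae_filter)
  define f' where "f' = (\<lambda>s. if s \<in> N then 0 else f s)"
  have "simple_function M (\<lambda>s. if s \<in> N then 0 else g n s)" for n
    using N(1) by (intro simple_function_If_set g(1)) auto
  moreover have "(\<lambda>n. if s \<in> N then 0 else g n s) \<longlonglongrightarrow> f' s" if "s \<in> space M" for s
    using N(2) that by (auto simp: f'_def)
  ultimately have "strongly_measurable M f'"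
    unfolding strongly_measurable_def
    by (intro exI[of _ "\<lambda>n s. if s \<in> N then 0 else g n s"]) auto
  moreover have "AE s in M. f s = f' s"
    using AE_not_in[OF N(1)] by eventually_elim (simp add: f'_def)
  ultimately show thesis using that by blast
qed

text \<open>For strongly measurable functions, an F-norm equivalent to \<open>fnorm\<close>.\<close>

definition mdist0 :: "'s measure \<Rightarrow> ('s \<Rightarrow> 'a::real_normed_vector) \<Rightarrow> real"
  where "mdist0 M f = (\<integral>s. min 1 (norm (f s)) \<partial>M)"

lemma mdist0_nonneg [simp]: "0 \<le> mdist0 M f"
  by (simp add: mdist0_def)

lemma mdist0_zero [simp]: "mdist0 M (\<lambda>_. 0) = 0"
  by (simp add: mdist0_def)

section \<open>Estimates for \<open>mdist0\<close> on a finite measure space\<close>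

context finite_measure
begin

lemma integrable_min_norm:
  assumes "strongly_measurable M f"
  shows "integrable M (\<lambda>s. min 1 (norm (f s)))"
proof (rule integrable_const_bound[of _ 1])
  show "(\<lambda>s. min 1 (norm (f s))) \<in> borel_measurable M"
    using strongly_measurable_norm[OF assms] by measurable
qed auto

lemma mdist0_mono_AE:
  assumes "strongly_measurable M f" "strongly_measurable M g" "AE s in M. norm (f s) \<le> norm (g s)"
  shows "mdist0 M f \<le> mdist0 M g"
  unfolding mdist0_def using assms(3)
  by (intro integral_mono_AE integrable_min_norm assms) auto

lemma mdist0_cong_AE:
  assumes "strongly_measurable M f" "strongly_measurable M g" "AE s in M. f s = g s"
  shows "mdist0 M f = mdist0 M g"
  using assms(3) by (intro antisym mdist0_mono_AE assms(1,2)) auto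

lemma mdist0_le_measure:
  assumes "strongly_measurable M f"
  shows "mdist0 M f \<le> measure M (space M)"
proof -
  have "mdist0 M f \<le> (\<integral>s. 1 \<partial>M)"
    unfolding mdist0_def by (intro integral_mono integrable_min_norm assms) auto
  then show ?thesis by simp
qed

lemma mdist0_triangle:
  assumes "strongly_measurable M f" "strongly_measurable M g"
  shows "mdist0 M (\<lambda>s. f s + g s) \<le> mdist0 M f + mdist0 M g"
proof -
  have "min 1 (norm (f s + g s)) \<le> min 1 (norm (f s)) + min 1 (norm (g s))" for s
    using norm_triangle_ineq[of "f s" "g s"] norm_ge_zero[of "f s"] norm_ge_zero[of "g s"]
    by linarith
  then have "mdist0 M (\<lambda>s. f s + g s) \<le> (\<integral>s. min 1 (norm (f s)) + min 1 (norm (g s)) \<partial>M)"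
    unfolding mdist0_def
    by (intro integral_mono integrable_min_norm Bochner_Integration.integrable_add
        strongly_measurable_add assms)
  also have "\<dots> = mdist0 M f + mdist0 M g"
    unfolding mdist0_def by (intro Bochner_Integration.integral_add integrable_min_norm assms)
  finally show ?thesis .
qed

lemma mdist0_minus: "mdist0 M (\<lambda>s. g s - f s) = mdist0 M (\<lambda>s. f s - g s)"
  by (simp add: mdist0_def norm_minus_commute)

lemma mdist0_triangle_diff:
  assumes "strongly_measurable M f" "strongly_measurable M g"
  shows "mdist0 M f \<le> mdist0 M (\<lambda>s. f s - g s) + mdist0 M g"
  using mdist0_triangle[OF strongly_measurable_diff[OF assms] assms(2)] by simp

lemma mdist0_eq_0_iff:
  fixes f :: "'a \<Rightarrow> 'b::real_normed_vector"
  assumes "strongly_measurable M f"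
  shows "mdist0 M f = 0 \<longleftrightarrow> (AE s in M. f s = 0)"
proof -
  have "mdist0 M f = 0 \<longleftrightarrow> (AE s in M. min 1 (norm (f s)) = 0)"
    unfolding mdist0_def by (intro integral_nonneg_eq_0_iff_AE integrable_min_norm assms) auto
  moreover have "min 1 (norm x) = 0 \<longleftrightarrow> x = 0" for x :: 'b
    by (auto simp: min_def)
  ultimately show ?thesis by simp
qed

text \<open>The summand 1 in the factor takes care of the truncation: where the norm of
  \<open>f s\<close> exceeds 1, the right-hand integrand is at least 1.\<close>

lemma mdist0_blinfun_le:
  assumes "strongly_measurable M f"
  shows "mdist0 M (\<lambda>s. blinfun_apply v (f s)) \<le> (1 + norm v) * mdist0 M f"
proof -
  have "min 1 (norm (blinfun_apply v x)) \<le> (1 + norm v) * min 1 (norm x)" for x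
  proof (cases "norm x \<le> 1")
    case True
    then have "norm (blinfun_apply v x) \<le> (1 + norm v) * norm x"
      using norm_blinfun[of v x] by (simp add: distrib_right add_increasing)
    with True show ?thesis by (simp add: min_def)
  qed (simp add: min.coboundedI1)
  then have "mdist0 M (\<lambda>s. blinfun_apply v (f s)) \<le> (\<integral>s. (1 + norm v) * min 1 (norm (f s)) \<partial>M)"
    unfolding mdist0_def
    by (intro integral_mono integrable_min_norm integrable_mult_right strongly_measurable_blinfun assms)
  then show ?thesis by (simp add: mdist0_def)
qed

text \<open>Dominated convergence for \<open>min 1 (norm (f s) / Suc n)\<close>. Since
  \<open>f\<close> may be unbounded, \<open>d\<close> depends on \<open>f\<close>.\<close>

lemma mdist0_small_functional:
  fixes f :: "'a \<Rightarrow> 'b::real_normed_vector"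
  assumes f: "strongly_measurable M f" and "0 < e"
  shows "\<exists>d>0. \<forall>v :: 'b \<Rightarrow>\<^sub>L 'c::real_normed_vector.
    norm v \<le> d \<longrightarrow> mdist0 M (\<lambda>s. blinfun_apply v (f s)) \<le> e"
proof -
  have "(\<lambda>n. \<integral>s. min 1 (norm (f s) / Suc n) \<partial>M) \<longlonglongrightarrow> (\<integral>s. 0 \<partial>M)"
  proof (rule integral_dominated_convergence[where w = "\<lambda>_. 1"])
    show "AE s in M. (\<lambda>n. min 1 (norm (f s) / Suc n)) \<longlonglongrightarrow> 0"
    proof (intro AE_I2)
      fix s
      have "(\<lambda>n. norm (f s) / Suc n) \<longlonglongrightarrow> 0"
        by (intro LIMSEQ_Suc lim_const_over_n)
      from tendsto_min[OF tendsto_const[of 1] this]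
      show "(\<lambda>n. min 1 (norm (f s) / Suc n)) \<longlonglongrightarrow> 0" by simp
    qed
  qed (use strongly_measurable_norm[OF f] in \<open>auto\<close>)
  then have "(\<lambda>n. \<integral>s. min 1 (norm (f s) / Suc n) \<partial>M) \<longlonglongrightarrow> 0" by simp
  from order_tendstoD(2)[OF this \<open>0 < e\<close>]
  obtain n where n: "(\<integral>s. min 1 (norm (f s) / Suc n) \<partial>M) < e"
    by (auto simp: eventually_sequentially)
  have "mdist0 M (\<lambda>s. blinfun_apply v (f s)) \<le> e" if v: "norm v \<le> 1 / Suc n" for v :: "'b \<Rightarrow>\<^sub>L 'c"
  proof -
    have "norm (blinfun_apply v x) \<le> norm x / Suc n" for x
      using norm_blinfun[of v x] mult_right_mono[OF v norm_ge_zero[of x]] by simp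
    then have "min 1 (norm (blinfun_apply v x)) \<le> min 1 (norm x / Suc n)" for x
      by (intro min.mono order_refl)
    then have "mdist0 M (\<lambda>s. blinfun_apply v (f s)) \<le> (\<integral>s. min 1 (norm (f s) / Suc n) \<partial>M)"
      unfolding mdist0_def
      using strongly_measurable_norm[OF f]
      by (intro integral_mono integrable_min_norm strongly_measurable_blinfun f
          integrable_const_bound[of _ 1]) auto
    with n show ?thesis by simp
  qed
  then show ?thesis
    by (intro exI[of _ "1 / Suc n"]) auto
qed

text \<open>Splitting at the set where the norm is at least \<open>\<epsilon>\<close> bounds the
  integral by \<open>\<epsilon>\<close> plus \<open>\<epsilon>\<close> times the total mass.\<close>

lemma mdist0_tendsto_0_if_fnorm:
  assumes f: "\<And>n. strongly_measurable M (f n)" and lim: "(\<lambda>n. fnorm M (f n)) \<longlonglongrightarrow> 0"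
  shows "(\<lambda>n. mdist0 M (f n)) \<longlonglongrightarrow> 0"
proof -
  have le: "mdist0 M (f n) \<le> (1 + measure M (space M)) * \<delta>" if "fnorm M (f n) < \<delta>" for n \<delta>
  proof -
    define E where
      "E = {\<epsilon>. 0 < \<epsilon> \<and> outer_measure_of M {s \<in> space M. norm (f n s) \<ge> \<epsilon>} \<le> ennreal \<epsilon>}"
    have meas: "{s \<in> space M. norm (f n s) \<ge> \<epsilon>} \<in> sets M" for \<epsilon>
      using strongly_measurable_norm[OF f[of n]] by measurable
    have "outer_measure_of M {s \<in> space M. norm (f n s) \<ge> \<epsilon>} \<le> ennreal (1 + measure M (space M))" for \<epsilon>
      using meas[of \<epsilon>] bounded_measure[of "{s \<in> space M. norm (f n s) \<ge> \<epsilon>}"]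
      by (simp add: emeasure_eq_measure del: ennreal_plus)
    \<comment> \<open>An explicit member makes the infimum meaningful; the 1 keeps it positive when
      \<open>M\<close> is the zero measure.\<close>
    then have "1 + measure M (space M) \<in> E"
      unfolding E_def by (simp add: add_pos_nonneg)
    then have "E \<noteq> {}" by blast
    moreover have "Inf E < \<delta>"
      using that by (simp add: fnorm_def E_def)
    ultimately obtain \<epsilon> where "\<epsilon> \<in> E" and \<epsilon>: "\<epsilon> < \<delta>"
      using cInf_lessD by blast
    then have \<epsilon>_pos: "0 < \<epsilon>"
      and outer: "outer_measure_of M {s \<in> space M. norm (f n s) \<ge> \<epsilon>} \<le> ennreal \<epsilon>"
      by (simp_all add: E_def)
    define H where "H = {s \<in> space M. norm (f n s) \<ge> \<epsilon>}"
    have H: "H \<in> sets M" "measure M H \<le> \<epsilon>"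
      using \<epsilon>_pos outer meas[of \<epsilon>] by (simp_all add: H_def emeasure_eq_measure)
    have ind: "integrable M (indicator H :: _ \<Rightarrow> real)"
      using H(1) by (simp add: emeasure_eq_measure)
    have "mdist0 M (f n) \<le> (\<integral>s. indicator H s + \<epsilon> \<partial>M)"
      unfolding mdist0_def
    proof (intro integral_mono integrable_min_norm f Bochner_Integration.integrable_add ind)
      show "min 1 (norm (f n s)) \<le> indicator H s + \<epsilon>" if "s \<in> space M" for s
        using that \<epsilon>_pos by (auto simp: H_def indicator_def)
    qed simp
    also have "\<dots> = measure M H + \<epsilon> * measure M (space M)"
      using H(1) by (subst Bochner_Integration.integral_add) (auto simp: emeasure_eq_measure)
    also have "\<dots> \<le> \<epsilon> + \<epsilon> * measure M (space M)"
      using H(2) by simp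
    also have "\<dots> = (1 + measure M (space M)) * \<epsilon>"
      by (simp add: algebra_simps)
    also have "\<dots> \<le> (1 + measure M (space M)) * \<delta>"
      using \<epsilon> by (intro mult_left_mono) auto
    finally show ?thesis .
  qed
  show ?thesis
  proof (rule LIMSEQ_I)
    fix r :: real
    assume r: "0 < r"
    define c where "c = 1 + measure M (space M)"
    have c: "0 < c" by (simp add: c_def add_pos_nonneg)
    with r have "0 < r / (2 * c)" by simp
    from order_tendstoD(2)[OF lim this]
    obtain N where "\<And>n. n \<ge> N \<Longrightarrow> fnorm M (f n) < r / (2 * c)"
      by (auto simp: eventually_sequentially)
    then have "mdist0 M (f n) \<le> r / 2" if "n \<ge> N" for n
      using le[of n "r / (2 * c)"] that c by (auto simp: c_def[symmetric])
    with r show "\<exists>N. \<forall>n\<ge>N. norm (mdist0 M (f n) - 0) < r"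
      by (intro exI[of _ N]) force
  qed
qed

end

section \<open>Measures with values in the space of measurable functions\<close>

lemma tendsto_0_if_le:
  fixes f g :: "nat \<Rightarrow> real"
  assumes "\<And>n. 0 \<le> f n" "\<And>n. f n \<le> g n" "g \<longlonglongrightarrow> 0"
  shows "f \<longlonglongrightarrow> 0"
  using tendsto_sandwich[of "\<lambda>_. 0" f sequentially g 0] assms by simp

text \<open>\<open>F A\<close> plays the role of a chosen representative of a class, so additivity
  holds only almost everywhere.\<close>

locale L0_valued_measure = finite_measure M + E: sigma_algebra \<Omega> \<E>
  for M :: "'s measure" and \<Omega> :: "'e set" and \<E> :: "'e set set" +
  fixes F :: "'e set \<Rightarrow> 's \<Rightarrow> 'a::real_normed_vector"
  assumes meas: "\<And>A. A \<in> \<E> \<Longrightarrow> strongly_measurable M (F A)"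
    and sums: "\<And>A. range A \<subseteq> \<E> \<Longrightarrow> disjoint_family A \<Longrightarrow>
      (\<lambda>n. mdist0 M (\<lambda>s. (\<Sum>i<n. F (A i) s) - F (\<Union>i. A i) s)) \<longlonglongrightarrow> 0"
begin

definition null_on :: "'e set \<Rightarrow> bool"
  where "null_on A \<longleftrightarrow> A \<in> \<E> \<and> (\<forall>B\<in>\<E>. B \<subseteq> A \<longrightarrow> (AE s in M. F B s = 0))"

lemma meas_diff: "A \<in> \<E> \<Longrightarrow> B \<in> \<E> \<Longrightarrow> strongly_measurable M (\<lambda>s. F A s - F B s)"
  by (intro strongly_measurable_diff meas)

lemma meas_partial_sum:
  fixes A :: "nat \<Rightarrow> 'e set"
  shows "range A \<subseteq> \<E> \<Longrightarrow> strongly_measurable M (\<lambda>s. (\<Sum>i<n. F (A i) s) - F (\<Union>i. A i) s)"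
  by (intro strongly_measurable_diff strongly_measurable_sum meas E.countable_nat_UN) auto

lemma zero_iff: "A \<in> \<E> \<Longrightarrow> mdist0 M (F A) = 0 \<longleftrightarrow> (AE s in M. F A s = 0)"
  by (intro mdist0_eq_0_iff meas)

text \<open>For the constant sequence the \<open>n\<close>-th error is \<open>n - 1\<close> times
  \<open>F {}\<close>; it dominates \<open>F {}\<close> from \<open>n = 2\<close> on and yet tends
  to zero.\<close>

lemma empty: "AE s in M. F {} s = 0"
proof -
  have lim: "(\<lambda>n::nat. mdist0 M (\<lambda>s. (\<Sum>i<n. F {} s) - F {} s)) \<longlonglongrightarrow> 0"
    using sums[of "\<lambda>_. {}"] by (simp add: disjoint_family_on_def)
  have "mdist0 M (F {}) \<le> mdist0 M (\<lambda>s. (\<Sum>i<n. F {} s) - F {} s)" if "2 \<le> n" for n :: nat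
  proof (rule mdist0_mono_AE)
    show "AE s in M. norm (F {} s) \<le> norm ((\<Sum>i<n. F {} s) - F {} s)"
    proof (rule AE_I2)
      fix s
      have "(\<Sum>i<n. F {} s) - F {} s = (real n - 1) *\<^sub>R F {} s"
        by (simp add: algebra_simps scaleR_conv_of_real sum_constant_scaleR)
      then show "norm (F {} s) \<le> norm ((\<Sum>i<n. F {} s) - F {} s)"
        using that mult_right_mono[of 1 "real n - 1" "norm (F {} s)"] by simp
    qed
    show "strongly_measurable M (\<lambda>s. (\<Sum>i<n. F {} s) - F {} s)"
      using meas_partial_sum[of "\<lambda>_. {}" n] by simp
  qed (auto intro: meas)
  then have "mdist0 M (F {}) \<le> 0"
    using LIMSEQ_le_const[OF lim] by blast
  then show ?thesis
    using zero_iff[of "{}"] mdist0_nonneg[of M "F {}"] by auto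
qed

text \<open>For the sequence \<open>A, B, {}, {}, ...\<close> the \<open>mdist0\<close> of the error
  is constant from \<open>n = 2\<close> on, so it equals its limit 0.\<close>

lemma additive:
  assumes "A \<in> \<E>" "B \<in> \<E>" "A \<inter> B = {}"
  shows "AE s in M. F (A \<union> B) s = F A s + F B s"
proof -
  let ?C = "binaryset A B"
  have C: "range ?C \<subseteq> \<E>" "disjoint_family ?C" "(\<Union>i. ?C i) = A \<union> B"
    using assms by (auto simp: range_binaryset_eq disjoint_family_on_def binaryset_def UN_binaryset_eq)
  let ?f = "\<lambda>s. (F A s + F B s) - F (A \<union> B) s"
  have m: "strongly_measurable M ?f"
    using assms by (intro strongly_measurable_diff strongly_measurable_add meas) auto
  have "mdist0 M (\<lambda>s. (\<Sum>i<n. F (?C i) s) - F (A \<union> B) s) = mdist0 M ?f" if "2 \<le> n" for n :: nat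
  proof (rule mdist0_cong_AE)
    show "strongly_measurable M (\<lambda>s. (\<Sum>i<n. F (?C i) s) - F (A \<union> B) s)"
      using meas_partial_sum[OF C(1)] C(3) by simp
    show "AE s in M. (\<Sum>i<n. F (?C i) s) - F (A \<union> B) s = ?f s"
      using empty
    proof eventually_elim
      case (elim s)
      have "(\<Sum>i<n. F (?C i) s) = (\<Sum>i<2. F (?C i) s) + (\<Sum>i=2..<n. F (?C i) s)"
        using that by (simp add: sum.atLeastLessThan_concat lessThan_atLeast0)
      also have "(\<Sum>i=2..<n. F (?C i) s) = 0"
        using elim by (intro sum.neutral) (auto simp: binaryset_def)
      finally show ?case by (simp add: numeral_2_eq_2 binaryset_def)
    qed
  qed (rule m)
  then have "\<forall>\<^sub>F n in sequentially. mdist0 M (\<lambda>s. (\<Sum>i<n. F (?C i) s) - F (A \<union> B) s) = mdist0 M ?f"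
    by (auto simp: eventually_sequentially)
  from tendsto_cong[OF this] sums[OF C(1,2)] C(3) have "mdist0 M ?f = 0"
    by (simp add: tendsto_const_iff)
  then have "AE s in M. ?f s = 0"
    using mdist0_eq_0_iff[OF m] by simp
  then show ?thesis
    by eventually_elim simp
qed

lemma diff:
  assumes "A \<in> \<E>" "B \<in> \<E>" "B \<subseteq> A"
  shows "AE s in M. F (A - B) s = F A s - F B s"
proof -
  have "AE s in M. F (B \<union> (A - B)) s = F B s + F (A - B) s"
    using assms by (intro additive E.Diff) auto
  moreover have "B \<union> (A - B) = A" using assms(3) by blast
  ultimately show ?thesis by (auto elim: eventually_mono)
qed

lemma finite_additive:
  fixes A :: "nat \<Rightarrow> 'e set"
  assumes "range A \<subseteq> \<E>" "disjoint_family A"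
  shows "AE s in M. F (\<Union>i<n. A i) s = (\<Sum>i<n. F (A i) s)"
proof (induct n)
  case 0
  show ?case using empty by simp
next
  case (Suc n)
  have "AE s in M. F ((\<Union>i<n. A i) \<union> A n) s = F (\<Union>i<n. A i) s + F (A n) s"
  proof (intro additive)
    have "A i \<inter> A n = {}" if "i < n" for i
      using assms(2) that by (simp add: disjoint_family_on_def)
    then show "(\<Union>i<n. A i) \<inter> A n = {}" by blast
    show "(\<Union>i<n. A i) \<in> \<E>" "A n \<in> \<E>"
      using assms(1) by auto
  qed
  with Suc show ?case
    by eventually_elim (simp add: lessThan_Suc Un_commute add.commute)
qed

lemma mdist0_Un_le:
  assumes "A \<in> \<E>" "B \<in> \<E>" "A \<inter> B = {}"
  shows "mdist0 M (F (A \<union> B)) \<le> mdist0 M (F A) + mdist0 M (F B)"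
proof -
  have "mdist0 M (F (A \<union> B)) = mdist0 M (\<lambda>s. F A s + F B s)"
    using assms by (intro mdist0_cong_AE additive strongly_measurable_add meas) auto
  also have "\<dots> \<le> mdist0 M (F A) + mdist0 M (F B)"
    using assms by (intro mdist0_triangle meas)
  finally show ?thesis .
qed

lemma mdist0_le_diff:
  assumes "A \<in> \<E>" "B \<in> \<E>" "B \<subseteq> A"
  shows "mdist0 M (F A) \<le> mdist0 M (F (A - B)) + mdist0 M (F B)"
proof -
  have "mdist0 M (F ((A - B) \<union> B)) \<le> mdist0 M (F (A - B)) + mdist0 M (F B)"
    using assms by (intro mdist0_Un_le E.Diff) auto
  moreover have "(A - B) \<union> B = A" using assms(3) by blast
  ultimately show ?thesis by simp
qed

text \<open>\<open>mdist0 M (F B)\<close> need not be monotone in \<open>B\<close>; the difference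
  set pays for passing to a subset.\<close>

lemma mdist0_le_superset:
  assumes "A \<in> \<E>" "B \<in> \<E>" "B \<subseteq> A"
  shows "mdist0 M (F B) \<le> mdist0 M (F A) + mdist0 M (F (A - B))"
proof -
  have "mdist0 M (F B) \<le> mdist0 M (\<lambda>s. F B s - F A s) + mdist0 M (F A)"
    using assms by (intro mdist0_triangle_diff meas)
  also have "mdist0 M (\<lambda>s. F B s - F A s) = mdist0 M (\<lambda>s. F A s - F B s)"
    by (rule mdist0_minus)
  also have "\<dots> = mdist0 M (F (A - B))"
  proof (rule mdist0_cong_AE)
    show "AE s in M. F A s - F B s = F (A - B) s"
      using diff[OF assms] by eventually_elim simp
  qed (use assms in \<open>auto intro: meas meas_diff\<close>)
  finally show ?thesis by simp
qed

text \<open>Each term of the series is the difference of two consecutive errors of the partial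
  sums.\<close>

lemma exhaustive:
  fixes A :: "nat \<Rightarrow> 'e set"
  assumes "range A \<subseteq> \<E>" "disjoint_family A"
  shows "(\<lambda>n. mdist0 M (F (A n))) \<longlonglongrightarrow> 0"
proof -
  let ?f = "\<lambda>n s. (\<Sum>i<n. F (A i) s) - F (\<Union>i. A i) s"
  note lim = sums[OF assms]
  have "mdist0 M (F (A n)) \<le> mdist0 M (?f (Suc n)) + mdist0 M (?f n)" for n
  proof -
    have "mdist0 M (F (A n)) \<le> mdist0 M (\<lambda>s. F (A n) s - - ?f n s) + mdist0 M (\<lambda>s. - ?f n s)"
      using assms(1) meas_partial_sum[OF assms(1), of n]
      by (intro mdist0_triangle_diff meas) (auto dest: strongly_measurable_diff[OF strongly_measurable_zero])
    also have "(\<lambda>s. F (A n) s - - ?f n s) = ?f (Suc n)"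
      by (auto simp: algebra_simps)
    also have "mdist0 M (\<lambda>s. - ?f n s) = mdist0 M (?f n)"
      by (simp add: mdist0_minus)
    finally show ?thesis .
  qed
  moreover have "(\<lambda>n. mdist0 M (?f (Suc n)) + mdist0 M (?f n)) \<longlonglongrightarrow> 0"
    using tendsto_add[OF LIMSEQ_Suc[OF lim] lim] by simp
  ultimately show ?thesis
    by (intro tendsto_0_if_le[OF mdist0_nonneg])
qed

text \<open>The triangle inequality controls the partial sums, and the remaining error vanishes in
  the limit.\<close>

lemma mdist0_UN_le_suminf:
  assumes "range B \<subseteq> \<E>" "disjoint_family B" and le: "\<And>k. mdist0 M (F (B k)) \<le> e k" and "summable e"
  shows "mdist0 M (F (\<Union>k. B k)) \<le> suminf e"
proof -
  let ?f = "\<lambda>n s. (\<Sum>i<n. F (B i) s) - F (\<Union>i. B i) s"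
  have e: "0 \<le> e k" for k
    using le[of k] mdist0_nonneg[of M "F (B k)"] by linarith
  have m: "strongly_measurable M (\<lambda>s. \<Sum>i<n. F (B i) s)" for n
    using assms(1) by (intro strongly_measurable_sum meas) auto
  have sum: "mdist0 M (\<lambda>s. \<Sum>i<n. F (B i) s) \<le> (\<Sum>i<n. e i)" for n
  proof (induction n)
    case (Suc n)
    have "mdist0 M (\<lambda>s. (\<Sum>i<n. F (B i) s) + F (B n) s) \<le>
        mdist0 M (\<lambda>s. \<Sum>i<n. F (B i) s) + mdist0 M (F (B n))"
      using assms(1) by (intro mdist0_triangle m meas) auto
    with Suc le[of n] show ?case by simp
  qed simp
  have "mdist0 M (F (\<Union>k. B k)) \<le> mdist0 M (?f n) + suminf e" for n
  proof -
    have "mdist0 M (F (\<Union>k. B k)) \<le>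
        mdist0 M (\<lambda>s. F (\<Union>k. B k) s - (\<Sum>i<n. F (B i) s)) + mdist0 M (\<lambda>s. \<Sum>i<n. F (B i) s)"
      using assms(1) by (intro mdist0_triangle_diff m meas) auto
    also have "mdist0 M (\<lambda>s. F (\<Union>k. B k) s - (\<Sum>i<n. F (B i) s)) = mdist0 M (?f n)"
      by (rule mdist0_minus)
    also have "mdist0 M (\<lambda>s. \<Sum>i<n. F (B i) s) \<le> suminf e"
      using sum[of n] sum_le_suminf[OF assms(4), of "{..<n}"] e by force
    finally show ?thesis by simp
  qed
  moreover have "(\<lambda>n. mdist0 M (?f n) + suminf e) \<longlonglongrightarrow> 0 + suminf e"
    by (intro tendsto_add sums assms tendsto_const)
  ultimately show ?thesis
    using LIMSEQ_le_const by fastforce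
qed

text \<open>The first \<open>Suc n\<close> disjoint differences have union \<open>B n\<close>, so
  the error of that partial sum is, up to sign, the measure of what remains.\<close>

lemma continuous_incseq:
  assumes "range B \<subseteq> \<E>" "incseq B"
  shows "(\<lambda>n. mdist0 M (F ((\<Union>i. B i) - B n))) \<longlonglongrightarrow> 0"
proof -
  let ?D = "disjointed B"
  have D: "range ?D \<subseteq> \<E>" "disjoint_family ?D" "(\<Union>i. ?D i) = (\<Union>i. B i)"
    by (simp_all add: E.range_disjointed_sets[OF assms(1)] disjoint_family_disjointed UN_disjointed_eq)
  have U: "(\<Union>i<Suc n. ?D i) = B n" for n
    using assms(2) finite_UN_disjointed_eq[of B "Suc n"]
    by (auto simp: incseq_def atLeast0LessThan) (meson less_Suc_eq_le subsetD)
  have "mdist0 M (F ((\<Union>i. B i) - B n)) =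
      mdist0 M (\<lambda>s. (\<Sum>i<Suc n. F (?D i) s) - F (\<Union>i. ?D i) s)" for n
  proof -
    have "AE s in M. F ((\<Union>i. B i) - B n) s = F (\<Union>i. B i) s - F (B n) s"
      using assms(1) by (intro diff) auto
    moreover have "AE s in M. F (B n) s = (\<Sum>i<Suc n. F (?D i) s)"
      using finite_additive[OF D(1,2), of "Suc n"] U[of n] by simp
    ultimately have eq: "AE s in M. F ((\<Union>i. B i) - B n) s = F (\<Union>i. B i) s - (\<Sum>i<Suc n. F (?D i) s)"
      by eventually_elim simp
    have "mdist0 M (F ((\<Union>i. B i) - B n)) = mdist0 M (\<lambda>s. F (\<Union>i. B i) s - (\<Sum>i<Suc n. F (?D i) s))"
    proof (intro mdist0_cong_AE eq)
      show "strongly_measurable M (F ((\<Union>i. B i) - B n))"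
        using assms(1) by (intro meas) auto
      show "strongly_measurable M (\<lambda>s. F (\<Union>i. B i) s - (\<Sum>i<Suc n. F (?D i) s))"
        using D(1) assms(1) by (intro strongly_measurable_diff strongly_measurable_sum meas) auto
    qed
    then show ?thesis
      using D(3) by (simp only: mdist0_minus[of "F (\<Union>i. B i)"])
  qed
  with LIMSEQ_Suc[OF sums[OF D(1,2)]] show ?thesis by simp
qed

lemma continuous_decseq:
  assumes "range B \<subseteq> \<E>" "decseq B"
  shows "(\<lambda>n. mdist0 M (F (B n - (\<Inter>i. B i)))) \<longlonglongrightarrow> 0"
proof -
  have "(\<Union>i. \<Omega> - B i) - (\<Omega> - B n) = B n - (\<Inter>i. B i)" for n
    using assms(1) E.sets_into_space by blast
  moreover have "(\<lambda>n. mdist0 M (F ((\<Union>i. \<Omega> - B i) - (\<Omega> - B n)))) \<longlonglongrightarrow> 0"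
    using assms by (intro continuous_incseq) (auto simp: decseq_def incseq_def)
  ultimately show ?thesis by simp
qed

text \<open>A gliding hump: if every \<open>H k\<close> contained a set of size above
  \<open>e\<close>, continuity would leave more than \<open>e / 2\<close> of it outside some later
  \<open>H l\<close>, and the resulting disjoint pieces would contradict
  \<open>exhaustive\<close>.\<close>

lemma uniformly_small_tail:
  assumes "range H \<subseteq> \<E>" "decseq H" "(\<Inter>i. H i) = {}" "0 < e"
  shows "\<exists>k. \<forall>B\<in>\<E>. B \<subseteq> H k \<longrightarrow> mdist0 M (F B) \<le> e"
proof (rule ccontr)
  assume contra: "\<not> ?thesis"
  have step: "\<exists>l. True \<and> (k < l \<and> (\<exists>C\<in>\<E>. C \<subseteq> H k - H l \<and> e / 2 < mdist0 M (F C)))" for k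
  proof -
    obtain B where B: "B \<in> \<E>" "B \<subseteq> H k" "e < mdist0 M (F B)"
      using contra by (auto simp: not_le)
    have "(\<lambda>l. mdist0 M (F (B \<inter> H l - (\<Inter>l. B \<inter> H l)))) \<longlonglongrightarrow> 0"
      using assms B by (intro continuous_decseq) (auto simp: decseq_def)
    also have "(\<Inter>l. B \<inter> H l) = {}" using assms(3) by auto
    finally have lim: "(\<lambda>l. mdist0 M (F (B \<inter> H l))) \<longlonglongrightarrow> 0" by simp
    have "\<forall>\<^sub>F l in sequentially. mdist0 M (F (B \<inter> H l)) < e / 2 \<and> k < l"
      using assms(4) by (intro eventually_conj order_tendstoD(2)[OF lim] eventually_gt_at_top) auto
    then obtain l where l: "mdist0 M (F (B \<inter> H l)) < e / 2" "k < l"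
      by (auto simp: eventually_sequentially)
    have "mdist0 M (F B) \<le> mdist0 M (F (B - B \<inter> H l)) + mdist0 M (F (B \<inter> H l))"
      using B assms by (intro mdist0_le_diff E.Int) auto
    then have "e / 2 < mdist0 M (F (B - H l))"
      using B(3) l(1) by (simp add: Diff_Int)
    moreover have "B - H l \<in> \<E>" "B - H l \<subseteq> H k - H l"
      using B assms(1) by (auto intro!: E.Diff)
    ultimately show ?thesis using l(2) by blast
  qed
  have "\<exists>k. \<forall>n. True \<and> k n < k (Suc n) \<and>
      (\<exists>C\<in>\<E>. C \<subseteq> H (k n) - H (k (Suc n)) \<and> e / 2 < mdist0 M (F C))"
    by (rule dependent_nat_choice[of "\<lambda>_ _. True" "\<lambda>_ k l. k < l \<and>
        (\<exists>C\<in>\<E>. C \<subseteq> H k - H l \<and> e / 2 < mdist0 M (F C))"]) (blast, rule step)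
  then obtain k where k: "\<And>n. k n < k (Suc n)"
    "\<And>n :: nat. \<exists>C\<in>\<E>. C \<subseteq> H (k n) - H (k (Suc n)) \<and> e / 2 < mdist0 M (F C)"
    by blast
  then obtain C where C: "\<And>n. C n \<in> \<E>" "\<And>n. C n \<subseteq> H (k n) - H (k (Suc n))"
    "\<And>n. e / 2 < mdist0 M (F (C n))"
    by metis
  have mono: "k m \<le> k n" if "m \<le> n" for m n
    using lift_Suc_mono_le[of k m n] k(1) that by (simp add: less_imp_le)
  have "C m \<inter> C n = {}" if "m < n" for m n
  proof -
    have "H (k n) \<subseteq> H (k (Suc m))"
      using assms(2) mono[of "Suc m" n] that by (simp add: decseq_def)
    then show ?thesis using C(2)[of m] C(2)[of n] by blast
  qed
  then have "disjoint_family C"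
    unfolding disjoint_family_on_def by (metis inf_commute nat_neq_iff)
  with C(1) have "(\<lambda>n. mdist0 M (F (C n))) \<longlonglongrightarrow> 0"
    by (intro exhaustive) auto
  from order_tendstoD(2)[OF this, of "e / 2"] assms(4) C(3) show False
    by (auto simp: eventually_sequentially not_less[symmetric] dest: less_imp_le less_asym)
qed

text \<open>A countable union of sets in \<open>\<I>\<close>, chosen greedily, absorbs all sets in \<open>\<I>\<close> up to null sets.\<close>

lemma ex_largest_mod_null:
  assumes "\<I> \<subseteq> \<E>" "{} \<in> \<I>" and Union: "\<And>A :: nat \<Rightarrow> 'e set. range A \<subseteq> \<I> \<Longrightarrow> (\<Union>i. A i) \<in> \<I>"
  obtains A where "A \<in> \<I>" "\<And>B. B \<in> \<I> \<Longrightarrow> null_on (B - A)"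
proof -
  \<comment> \<open>\<open>X A\<close> collects what members of \<open>\<I>\<close> can still add to
    \<open>A\<close>. The factor 2 in \<open>Q\<close> allows for a supremum that is not
    attained.\<close>
  define X where "X = (\<lambda>A. {C \<in> \<E>. \<exists>B\<in>\<I>. C \<subseteq> B - A})"
  define Q where "Q = (\<lambda>A A'. A \<subseteq> A' \<and> (\<exists>C\<in>\<E>. C \<subseteq> A' - A \<and>
    (\<forall>C'\<in>X A. mdist0 M (F C') \<le> 2 * mdist0 M (F C))))"
  have Un: "A \<union> B \<in> \<I>" if "A \<in> \<I>" "B \<in> \<I>" for A B
    using Union[of "binaryset A B"] that assms(2)
    by (auto simp: range_binaryset_eq UN_binaryset_eq)
  have "\<exists>A'. A' \<in> \<I> \<and> Q A A'" if A: "A \<in> \<I>" for A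
  proof -
    let ?S = "(\<lambda>C. mdist0 M (F C)) ` X A"
    have "{} \<in> X A" using assms(2) by (auto simp: X_def)
    have bdd: "bdd_above ?S"
      by (rule bdd_aboveI2[of _ _ "measure M (space M)"]) (auto simp: X_def intro: mdist0_le_measure meas)
    have "\<exists>C\<in>X A. \<forall>C'\<in>X A. mdist0 M (F C') \<le> 2 * mdist0 M (F C)"
    proof (cases "Sup ?S \<le> 0")
      case True
      then have "mdist0 M (F C') \<le> 0" if "C' \<in> X A" for C'
        using cSup_upper[OF imageI[OF that] bdd] by (auto intro: order_trans)
      then show ?thesis
        using \<open>{} \<in> X A\<close> by (intro bexI[of _ "{}"]) (auto intro: order_trans[OF _ mult_nonneg_nonneg])
    next
      case False
      then have "Sup ?S / 2 < Sup ?S" by simp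
      then obtain C where C: "C \<in> X A" "Sup ?S / 2 < mdist0 M (F C)"
        using less_cSupD[of ?S "Sup ?S / 2"] \<open>{} \<in> X A\<close> by blast
      have "mdist0 M (F C') \<le> 2 * mdist0 M (F C)" if "C' \<in> X A" for C'
        using cSup_upper[OF imageI[OF that] bdd] C(2) by auto
      with C(1) show ?thesis by blast
    qed
    then obtain C B where "C \<in> \<E>" "B \<in> \<I>" "C \<subseteq> B - A"
      "\<forall>C'\<in>X A. mdist0 M (F C') \<le> 2 * mdist0 M (F C)"
      unfolding X_def by blast
    then show ?thesis
      using Un[OF A] unfolding Q_def by (intro exI[of _ "A \<union> B"]) blast
  qed
  then obtain A where A: "\<And>n. A n \<in> \<I>" "\<And>n :: nat. Q (A n) (A (Suc n))"
    using dependent_nat_choice[of "\<lambda>_ A. A \<in> \<I>" "\<lambda>_. Q"] assms(2) by metis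
  then obtain C where C: "\<And>n. C n \<in> \<E>" "\<And>n. C n \<subseteq> A (Suc n) - A n"
    "\<And>n C'. C' \<in> X (A n) \<Longrightarrow> mdist0 M (F C') \<le> 2 * mdist0 M (F (C n))"
    unfolding Q_def by metis
  have mono: "A m \<subseteq> A n" if "m \<le> n" for m n
    using lift_Suc_mono_le[of A m n] A(2) that by (simp add: Q_def)
  have "C m \<inter> C n = {}" if "m < n" for m n
    using mono[of "Suc m" n] that C(2)[of m] C(2)[of n] by auto
  then have "disjoint_family C"
    unfolding disjoint_family_on_def by (metis inf_commute nat_neq_iff)
  with C(1) have lim: "(\<lambda>n. mdist0 M (F (C n))) \<longlonglongrightarrow> 0"
    by (intro exhaustive) auto
  show thesis
  proof
    show U: "(\<Union>n. A n) \<in> \<I>" using A(1) by (intro Union) auto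
    fix B assume B: "B \<in> \<I>"
    show "null_on (B - (\<Union>n. A n))"
      unfolding null_on_def
    proof (intro conjI ballI impI)
      show "B - (\<Union>n. A n) \<in> \<E>" using B U assms(1) by blast
      fix D assume D: "D \<in> \<E>" "D \<subseteq> B - (\<Union>n. A n)"
      \<comment> \<open>\<open>D\<close> is available at every stage, so its size is at most twice
        that of each of the disjoint sets \<open>C n\<close>.\<close>
      then have "mdist0 M (F D) \<le> 2 * mdist0 M (F (C n))" for n
        using B by (intro C(3)) (auto simp: X_def)
      then have "mdist0 M (F D) \<le> 2 * 0"
        by (intro LIMSEQ_le_const[OF tendsto_mult[OF tendsto_const lim]]) auto
      then show "AE s in M. F D s = 0"
        using zero_iff[OF D(1)] mdist0_nonneg[of M "F D"] by auto
    qed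
  qed
qed

section \<open>Null sets and derived measures\<close>

lemma null_on_subset: "null_on A \<Longrightarrow> B \<in> \<E> \<Longrightarrow> B \<subseteq> A \<Longrightarrow> null_on B"
  by (auto simp: null_on_def)

lemma null_on_UN:
  assumes "\<And>i :: nat. null_on (A i)"
  shows "null_on (\<Union>i. A i)"
  unfolding null_on_def
proof (intro conjI ballI impI)
  have A: "A i \<in> \<E>" for i using assms by (simp add: null_on_def)
  then show "(\<Union>i. A i) \<in> \<E>" by auto
  fix B assume B: "B \<in> \<E>" "B \<subseteq> (\<Union>i. A i)"
  define C where "C = (\<lambda>i. B \<inter> disjointed A i)"
  have dA: "disjointed A i \<in> \<E>" for i
    using E.range_disjointed_sets[of A] A by auto
  have "(\<Union>i. C i) = B"
    using B(2) UN_disjointed_eq[of A] by (auto simp: C_def)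
  moreover have "mdist0 M (F (\<Union>i. C i)) \<le> suminf (\<lambda>_. 0)"
  proof (rule mdist0_UN_le_suminf)
    show "range C \<subseteq> \<E>" using B(1) dA by (auto simp: C_def)
    show "disjoint_family C"
      using disjoint_family_disjointed[of A] by (auto simp: C_def disjoint_family_on_def)
    fix i
    have "C i \<subseteq> A i" using disjointed_subset[of A i] by (auto simp: C_def)
    then have "AE s in M. F (C i) s = 0"
      using assms[of i] B(1) dA[of i] by (auto simp: null_on_def C_def)
    then show "mdist0 M (F (C i)) \<le> 0"
      using zero_iff[of "C i"] E.Int[OF B(1) dA[of i]] by (simp add: C_def)
  qed simp
  ultimately show "AE s in M. F B s = 0"
    using zero_iff[OF B(1)] mdist0_nonneg[of M "F B"] by auto
qed

text \<open>In a smaller \<sigma>-algebra a set is null more easily, since fewer subsets are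
  tested.\<close>

lemma L0_valued_measure_subalgebra:
  assumes "sigma_algebra \<Omega> \<A>" "\<A> \<subseteq> \<E>"
  shows "L0_valued_measure M \<Omega> \<A> F"
  using assms meas sums
  by (intro L0_valued_measure.intro L0_valued_measure_axioms.intro finite_measure_axioms) auto

lemma L0_valued_measure_blinfun:
  "L0_valued_measure M \<Omega> \<E> (\<lambda>A s. blinfun_apply v (F A s))"
proof unfold_locales
  show "strongly_measurable M (\<lambda>s. blinfun_apply v (F A s))" if "A \<in> \<E>" for A
    using meas[OF that] by blast
  fix A :: "nat \<Rightarrow> 'e set"
  assume A: "range A \<subseteq> \<E>" "disjoint_family A"
  let ?f = "\<lambda>n s. (\<Sum>i<n. F (A i) s) - F (\<Union>i. A i) s"
  have "mdist0 M (\<lambda>s. blinfun_apply v (?f n s)) \<le> (1 + norm v) * mdist0 M (?f n)" for n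
    by (intro mdist0_blinfun_le meas_partial_sum A)
  moreover have "(\<lambda>n. (1 + norm v) * mdist0 M (?f n)) \<longlonglongrightarrow> 0"
    by (intro tendsto_mult_right_zero sums A)
  ultimately have "(\<lambda>n. mdist0 M (\<lambda>s. blinfun_apply v (?f n s))) \<longlonglongrightarrow> 0"
    by (intro tendsto_0_if_le[OF mdist0_nonneg])
  then show "(\<lambda>n. mdist0 M (\<lambda>s. (\<Sum>i<n. blinfun_apply v (F (A i) s)) -
      blinfun_apply v (F (\<Union>i. A i) s))) \<longlonglongrightarrow> 0"
    by (simp add: blinfun.diff_right blinfun.sum_right)
qed

end

section \<open>Functionals annihilating a large set form a nowhere dense set\<close>

text \<open>For an algebra \<open>\<T>\<close> this is the algebra generated by \<open>\<T>\<close>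
  and \<open>A\<close>, in a form that shows it to be finite if \<open>\<T>\<close> is.\<close>

definition algebra_insert :: "'e set set \<Rightarrow> 'e set \<Rightarrow> 'e set set"
  where "algebra_insert \<T> A = (\<lambda>(P, Q). (P \<inter> A) \<union> (Q - A)) ` (\<T> \<times> \<T>)"

lemma algebra_algebra_insert:
  assumes "algebra \<Omega> \<T>" "A \<subseteq> \<Omega>"
  shows "algebra \<Omega> (algebra_insert \<T> A)"
    and "\<T> \<subseteq> algebra_insert \<T> A"
    and "A \<in> algebra_insert \<T> A"
proof -
  interpret algebra \<Omega> \<T> by fact
  have I: "(P \<inter> A) \<union> (Q - A) \<in> algebra_insert \<T> A" if "P \<in> \<T>" "Q \<in> \<T>" for P Q
    using that by (auto simp: algebra_insert_def)
  have E: "\<exists>P\<in>\<T>. \<exists>Q\<in>\<T>. S = (P \<inter> A) \<union> (Q - A)" if "S \<in> algebra_insert \<T> A" for S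
    using that by (auto simp: algebra_insert_def)
  have "S \<in> algebra_insert \<T> A" if "S \<in> \<T>" for S
    using I[OF that that] by (simp add: Int_Diff_Un)
  then show "\<T> \<subseteq> algebra_insert \<T> A" by blast
  show "A \<in> algebra_insert \<T> A"
    using I[of \<Omega> "{}"] assms(2) by (simp add: Int_absorb1)
  show "algebra \<Omega> (algebra_insert \<T> A)"
    unfolding algebra_iff_Un
  proof (intro conjI ballI)
    show "algebra_insert \<T> A \<subseteq> Pow \<Omega>"
      using E space_closed assms(2) by blast
    show "{} \<in> algebra_insert \<T> A"
      using I[of "{}" "{}"] by simp
    fix S assume "S \<in> algebra_insert \<T> A"
    then obtain P Q where PQ: "P \<in> \<T>" "Q \<in> \<T>" "S = (P \<inter> A) \<union> (Q - A)" using E by blast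
    have "\<Omega> - S = ((\<Omega> - P) \<inter> A) \<union> ((\<Omega> - Q) - A)"
      using assms(2) PQ(3) by blast
    then show "\<Omega> - S \<in> algebra_insert \<T> A"
      using I[of "\<Omega> - P" "\<Omega> - Q"] PQ by auto
    fix S' assume "S' \<in> algebra_insert \<T> A"
    then obtain P' Q' where PQ': "P' \<in> \<T>" "Q' \<in> \<T>" "S' = (P' \<inter> A) \<union> (Q' - A)" using E by blast
    have "S \<union> S' = ((P \<union> P') \<inter> A) \<union> ((Q \<union> Q') - A)"
      using PQ(3) PQ'(3) by blast
    then show "S \<union> S' \<in> algebra_insert \<T> A"
      using I[of "P \<union> P'" "Q \<union> Q'"] PQ PQ' by auto
  qed
qed

lemma nested_cballs_limit:
  fixes c :: "nat \<Rightarrow> 'a::banach"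
  assumes nested: "\<And>k. cball (c (Suc k)) (\<rho> (Suc k)) \<subseteq> cball (c k) (\<rho> k)"
    and \<rho>: "\<And>k. 0 < \<rho> k" "\<And>k. \<rho> (Suc k) \<le> (1/2) ^ k"
  obtains a where "\<And>k. dist (c k) a \<le> \<rho> k"
proof -
  have sub: "cball (c n) (\<rho> n) \<subseteq> cball (c k) (\<rho> k)" if "k \<le> n" for k n
    using lift_Suc_antimono_le[of "\<lambda>k. cball (c k) (\<rho> k)"] nested that by blast
  have d: "dist (c k) (c n) \<le> \<rho> k" if "k \<le> n" for k n
    using sub[OF that] \<rho>(1)[of n] by (auto simp: subset_iff less_imp_le)
  have "Cauchy c"
  proof (rule metric_CauchyI)
    fix e :: real
    assume "0 < e"
    then obtain k where k: "(1/2) ^ k < e / 2"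
      using real_arch_pow_inv[of "e / 2" "1/2"] by auto
    have "dist (c m) (c n) < e" if "Suc k \<le> m" "Suc k \<le> n" for m n
      using dist_triangle3[of "c m" "c n" "c (Suc k)"] d[OF that(1)] d[OF that(2)] \<rho>(2)[of k] k
      by linarith
    then show "\<exists>K. \<forall>m\<ge>K. \<forall>n\<ge>K. dist (c m) (c n) < e" by blast
  qed
  then obtain a where a: "c \<longlonglongrightarrow> a"
    using Cauchy_convergent convergent_def by blast
  have "dist (c k) a \<le> \<rho> k" for k
    using d[of k] by (intro LIMSEQ_le_const2[OF tendsto_dist[OF tendsto_const a]]) auto
  then show thesis using that by blast
qed

section \<open>Annihilating functionals and the inductive construction\<close>

context L0_valued_measure
begin

definition kills :: "('a \<Rightarrow>\<^sub>L 'k::real_normed_vector) \<Rightarrow> real \<Rightarrow> ('a \<Rightarrow>\<^sub>L 'k) \<Rightarrow> bool"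
  where "kills w e z \<longleftrightarrow>
    (\<exists>A\<in>\<E>. e \<le> mdist0 M (\<lambda>s. blinfun_apply w (F A s)) \<and>
      (\<forall>B\<in>\<E>. B \<subseteq> A \<longrightarrow> (AE s in M. blinfun_apply z (F B s) = 0)))"

lemma small_functional_finite:
  assumes "finite \<T>" "\<T> \<subseteq> \<E>" "0 < e"
  shows "\<exists>d>0. \<forall>v :: 'a \<Rightarrow>\<^sub>L 'k::real_normed_vector. norm v \<le> d \<longrightarrow>
    (\<forall>B\<in>\<T>. mdist0 M (\<lambda>s. blinfun_apply v (F B s)) \<le> e)"
  using assms(1,2)
proof (induction \<T> rule: finite_induct)
  case empty
  show ?case by (intro exI[of _ 1]) auto
next
  case (insert B \<T>)
  then obtain d where d: "0 < d" "\<And>v :: 'a \<Rightarrow>\<^sub>L 'k. norm v \<le> d \<Longrightarrow>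
      \<forall>B\<in>\<T>. mdist0 M (\<lambda>s. blinfun_apply v (F B s)) \<le> e"
    by auto
  obtain d' where d': "0 < d'" "\<And>v :: 'a \<Rightarrow>\<^sub>L 'k. norm v \<le> d' \<Longrightarrow>
      mdist0 M (\<lambda>s. blinfun_apply v (F B s)) \<le> e"
    using mdist0_small_functional[OF meas assms(3), of B] insert.prems by auto
  show ?case
    by (intro exI[of _ "min d d'"]) (use d d' in auto)
qed

text \<open>
  Every \<open>z i\<close> is a limit of functionals \<open>y k\<close> with \<open>\<tau> k = i\<close>. The estimates \<open>small\<close> make up for
  the absence of a bound on the range of the measure: they only concern the finitely many sets
  \<open>\<T> (Suc k)\<close> that are known when the distance of \<open>y k\<close> to \<open>z i\<close> is chosen.
\<close>

lemma annihilating_sequence_False: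
  fixes w a :: "'a \<Rightarrow>\<^sub>L 'k::real_normed_vector" and y :: "nat \<Rightarrow> 'a \<Rightarrow>\<^sub>L 'k"
    and t :: "nat \<Rightarrow> real" and \<tau> :: "nat \<Rightarrow> nat"
  assumes "inj t" and "0 < e"
    and \<tau>: "\<And>i n. \<exists>k\<ge>n. \<tau> k = i"
    and alg: "\<And>k. algebra \<Omega> (\<T> k)" "\<And>k. \<T> k \<subseteq> \<E>" "\<And>k. \<T> k \<subseteq> \<T> (Suc k)" "\<And>k. A k \<in> \<T> (Suc k)"
    and large: "\<And>k. e \<le> mdist0 M (\<lambda>s. blinfun_apply w (F (A k) s))"
    and kill: "\<And>k B. B \<in> \<E> \<Longrightarrow> B \<subseteq> A k \<Longrightarrow> AE s in M. blinfun_apply (y k) (F B s) = 0"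
    and small: "\<And>k B. B \<in> \<T> (Suc k) \<Longrightarrow>
      mdist0 M (\<lambda>s. blinfun_apply (a + t (\<tau> k) *\<^sub>R w - y k) (F B s)) \<le> (1/2) ^ k"
  shows False
proof -
  define z where "z = (\<lambda>i. a + t i *\<^sub>R w)"
  \<comment> \<open>\<open>G i n\<close> unites the \<open>A k\<close> with \<open>k \<ge> n\<close>
    and \<open>\<tau> k = i\<close>, so \<open>L i\<close> is their upper limit.\<close>
  define G where "G = (\<lambda>i n. \<Union>k. if \<tau> (n + k) = i then A (n + k) else {})"
  define L where "L = (\<lambda>i. \<Inter>n. G i n)"
  define \<A> where "\<A> = (\<Union>k. \<T> k)"
  \<comment> \<open>The estimates \<open>small\<close> reach only the algebras
    \<open>\<T> k\<close>; what they imply is therefore stated on the \<sigma>-algebra generated by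
    these.\<close>
  define \<S> where "\<S> = sigma_sets \<Omega> \<A>"
  have \<T>_mono: "\<T> k \<subseteq> \<T> l" if "k \<le> l" for k l
    using lift_Suc_mono_le[of \<T>] alg(3) that by blast
  have \<A>_\<E>: "\<A> \<subseteq> \<E>" using alg(2) by (auto simp: \<A>_def)
  have \<A>_Pow: "\<A> \<subseteq> Pow \<Omega>" using \<A>_\<E> E.space_closed by blast
  have \<S>_\<E>: "\<S> \<subseteq> \<E>" unfolding \<S>_def using \<A>_\<E> by (rule E.sigma_sets_subset)
  interpret S: sigma_algebra \<Omega> \<S>
    unfolding \<S>_def using \<A>_Pow by (rule sigma_algebra_sigma_sets)
  have A_\<S>: "A k \<in> \<S>" for k
    using alg(4)[of k] unfolding \<S>_def \<A>_def by blast
  have G_\<S>: "G i n \<in> \<S>" for i n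
    unfolding G_def using A_\<S> by (intro S.countable_UN) auto
  then have L_\<S>: "L i \<in> \<S>" for i
    unfolding L_def by (intro S.countable_INT) auto
  have G_dec: "decseq (G i)" for i
  proof (rule decseq_SucI)
    show "G i (Suc n) \<subseteq> G i n" for n
      unfolding G_def by (auto split: if_splits) (metis add_Suc_right)
  qed
  note \<S>\<E> = subsetD[OF \<S>_\<E>]
  interpret w: L0_valued_measure M \<Omega> \<E> "\<lambda>A s. blinfun_apply w (F A s)"
    by (rule L0_valued_measure_blinfun)
  interpret wS: L0_valued_measure M \<Omega> \<S> "\<lambda>A s. blinfun_apply w (F A s)"
    by (rule w.L0_valued_measure_subalgebra[OF S.sigma_algebra_axioms \<S>_\<E>])
  \<comment> \<open>\<open>B \<inter> G i n\<close> is cut into disjoint pieces \<open>D k\<close>,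
    empty or inside \<open>A (n + k)\<close>. There \<open>y (n + k)\<close> vanishes, so
    \<open>z i\<close> agrees with the difference estimated in \<open>small\<close>, and the bounds
    form a geometric series.\<close>
  have tail: "mdist0 M (\<lambda>s. blinfun_apply (z i) (F (B \<inter> G i n) s)) \<le> 2 * (1/2) ^ n"
    if B: "B \<in> \<T> l" and "l \<le> n" for i B l n
  proof -
    interpret z: L0_valued_measure M \<Omega> \<E> "\<lambda>A s. blinfun_apply (z i) (F A s)"
      by (rule L0_valued_measure_blinfun)
    define C where "C = (\<lambda>k. if \<tau> (n + k) = i then A (n + k) else {})"
    define D where "D = (\<lambda>k. B \<inter> disjointed C k)"
    \<comment> \<open>Only \<open>B\<close> and sets among \<open>A n, ..., A (n + k)\<close> enter
      \<open>D k\<close>, so it lies in the algebra to which \<open>small\<close> applies.\<close>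
    have D_\<T>: "D k \<in> \<T> (Suc (n + k))" for k
    proof -
      interpret T: algebra \<Omega> "\<T> (Suc (n + k))" by (rule alg)
      have C: "C j \<in> \<T> (Suc (n + k))" if "j \<le> k" for j
        using \<T>_mono[of "Suc (n + j)" "Suc (n + k)"] alg(4)[of "n + j"] that by (auto simp: C_def)
      then show ?thesis
        unfolding D_def disjointed_def
        using \<T>_mono[of l "Suc (n + k)"] B \<open>l \<le> n\<close>
        by (intro T.Int T.Diff T.finite_UN) auto
    qed
    have "mdist0 M (\<lambda>s. blinfun_apply (z i) (F (\<Union>k. D k) s)) \<le> (\<Sum>k. (1/2) ^ (n + k))"
    proof (rule z.mdist0_UN_le_suminf)
      show "range D \<subseteq> \<E>" using D_\<T> alg(2) by blast
      then have D_\<E>: "D k \<in> \<E>" for k by blast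
      show "disjoint_family D"
        using disjoint_family_disjointed[of C] by (auto simp: D_def disjoint_family_on_def)
      fix k
      show "mdist0 M (\<lambda>s. blinfun_apply (z i) (F (D k) s)) \<le> (1/2) ^ (n + k)"
      proof (cases "\<tau> (n + k) = i")
        case True
        have "D k \<subseteq> A (n + k)"
          using True disjointed_subset[of C k] by (auto simp: D_def C_def)
        then have "AE s in M. blinfun_apply (y (n + k)) (F (D k) s) = 0"
          by (intro kill D_\<E>)
        then have "AE s in M. blinfun_apply (z i) (F (D k) s) =
            blinfun_apply (a + t (\<tau> (n + k)) *\<^sub>R w - y (n + k)) (F (D k) s)"
          by eventually_elim (simp add: z_def True blinfun.diff_left)
        then have "mdist0 M (\<lambda>s. blinfun_apply (z i) (F (D k) s)) =
            mdist0 M (\<lambda>s. blinfun_apply (a + t (\<tau> (n + k)) *\<^sub>R w - y (n + k)) (F (D k) s))"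
          by (intro mdist0_cong_AE strongly_measurable_blinfun meas D_\<E>)
        with small[OF D_\<T>[of k]] show ?thesis by simp
      next
        case False
        then have "D k = {}"
          using disjointed_subset[of C k] by (auto simp: D_def C_def)
        then show ?thesis
          using z.zero_iff[of "{}"] z.empty by simp
      qed
    qed (simp add: power_add summable_mult summable_geometric)
    also have "(\<Union>k. D k) = B \<inter> G i n"
      using UN_disjointed_eq[of C] unfolding D_def G_def C_def by (metis Int_UN_distrib)
    also have "(\<Sum>k. (1/2) ^ (n + k)) = 2 * (1/2 :: real) ^ n"
      by (simp add: power_add suminf_mult suminf_geometric summable_geometric)
    finally show ?thesis .
  qed
  \<comment> \<open>As \<open>n\<close> grows, both the bound \<open>tail\<close> and the correction
    for passing from \<open>B \<inter> G i n\<close> to \<open>B \<inter> L i\<close> tend to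
    zero.\<close>
  have lim: "AE s in M. blinfun_apply (z i) (F (B \<inter> L i) s) = 0" if BA: "B \<in> \<A>" for i B
  proof -
    interpret z: L0_valued_measure M \<Omega> \<E> "\<lambda>A s. blinfun_apply (z i) (F A s)"
      by (rule L0_valued_measure_blinfun)
    obtain l where l: "B \<in> \<T> l" using BA by (auto simp: \<A>_def)
    have B: "B \<in> \<E>" using BA \<A>_\<E> by blast
    let ?d = "\<lambda>n. mdist0 M (\<lambda>s. blinfun_apply (z i) (F (B \<inter> G i n - B \<inter> L i) s))"
    have bound: "mdist0 M (\<lambda>s. blinfun_apply (z i) (F (B \<inter> L i) s)) \<le> 2 * (1/2) ^ n + ?d n"
      if "l \<le> n" for n
    proof -
      have "mdist0 M (\<lambda>s. blinfun_apply (z i) (F (B \<inter> L i) s)) \<le>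
          mdist0 M (\<lambda>s. blinfun_apply (z i) (F (B \<inter> G i n) s)) + ?d n"
        using B \<S>\<E>[OF G_\<S>] \<S>\<E>[OF L_\<S>]
        by (intro z.mdist0_le_superset E.Int) (auto simp: L_def)
      with tail[OF l that, of i] show ?thesis by simp
    qed
    have "decseq (\<lambda>n. B \<inter> G i n)"
      using G_dec[of i] unfolding decseq_def by blast
    moreover have "range (\<lambda>n. B \<inter> G i n) \<subseteq> \<E>"
      using B \<S>\<E>[OF G_\<S>] by auto
    ultimately have "(\<lambda>n. mdist0 M (\<lambda>s. blinfun_apply (z i) (F (B \<inter> G i n - (\<Inter>n. B \<inter> G i n)) s))) \<longlonglongrightarrow> 0"
      by (intro z.continuous_decseq)
    also have "(\<Inter>n. B \<inter> G i n) = B \<inter> L i" by (auto simp: L_def)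
    finally have "(\<lambda>n. 2 * (1/2) ^ n + ?d n) \<longlonglongrightarrow> 2 * 0 + 0"
      by (intro tendsto_add tendsto_mult tendsto_const LIMSEQ_power_zero) auto
    then have "mdist0 M (\<lambda>s. blinfun_apply (z i) (F (B \<inter> L i) s)) \<le> 2 * 0 + 0"
      by (rule LIMSEQ_le_const) (use bound in blast)
    then show ?thesis
      using z.zero_iff[of "B \<inter> L i"] B \<S>\<E>[OF L_\<S>]
        mdist0_nonneg[of M "\<lambda>s. blinfun_apply (z i) (F (B \<inter> L i) s)"] by auto
  qed
  \<comment> \<open>The union \<open>\<A>\<close> of the algebras is stable under intersections, so
    \<open>lim\<close> extends to the generated \<sigma>-algebra through complements and disjoint
    unions.\<close>
  have null: "AE s in M. blinfun_apply (z i) (F (B \<inter> L i) s) = 0" if "B \<in> \<S>" for i B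
  proof -
    interpret z: L0_valued_measure M \<Omega> \<E> "\<lambda>A s. blinfun_apply (z i) (F A s)"
      by (rule L0_valued_measure_blinfun)
    have "Int_stable \<A>"
    proof (rule Int_stableI)
      fix P Q assume "P \<in> \<A>" "Q \<in> \<A>"
      then obtain k l where "P \<in> \<T> k" "Q \<in> \<T> l" by (auto simp: \<A>_def)
      then have "P \<in> \<T> (max k l)" "Q \<in> \<T> (max k l)"
        using \<T>_mono[of k "max k l"] \<T>_mono[of l "max k l"] by auto
      then have "P \<inter> Q \<in> \<T> (max k l)"
        using alg(1)[of "max k l"] by (simp add: algebra_iff_Int)
      then show "P \<inter> Q \<in> \<A>" by (auto simp: \<A>_def)
    qed
    then show ?thesis
      using \<A>_Pow that[unfolded \<S>_def]
    proof (induction B rule: sigma_sets_induct_disjoint)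
      case (basic B)
      then show ?case by (rule lim)
    next
      case empty
      then show ?case using z.empty by simp
    next
      case (compl B)
      have B: "B \<in> \<E>" using compl(1) \<S>\<E> by (simp add: \<S>_def)
      have "\<Omega> \<in> \<A>" using algebra.top[OF alg(1)] by (auto simp: \<A>_def)
      then have "AE s in M. blinfun_apply (z i) (F (\<Omega> \<inter> L i) s) = 0" by (rule lim)
      moreover have "AE s in M. blinfun_apply (z i) (F (\<Omega> \<inter> L i - B \<inter> L i) s) =
          blinfun_apply (z i) (F (\<Omega> \<inter> L i) s) - blinfun_apply (z i) (F (B \<inter> L i) s)"
        using B \<S>\<E>[OF L_\<S>[of i]] E.sets_into_space by (intro z.diff E.Int) auto
      moreover have "\<Omega> \<inter> L i - B \<inter> L i = (\<Omega> - B) \<inter> L i" by blast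
      ultimately show ?case using compl(2) by (auto elim: eventually_elim2)
    next
      case (union B)
      have B: "B k \<in> \<E>" for k using union(2) \<S>\<E> by (auto simp: \<S>_def)
      have "mdist0 M (\<lambda>s. blinfun_apply (z i) (F (\<Union>k. B k \<inter> L i) s)) \<le> (\<Sum>k. 0)"
      proof (rule z.mdist0_UN_le_suminf)
        show "range (\<lambda>k. B k \<inter> L i) \<subseteq> \<E>" using B \<S>\<E>[OF L_\<S>] by auto
        show "disjoint_family (\<lambda>k. B k \<inter> L i)"
          using union(1) by (auto simp: disjoint_family_on_def)
        show "mdist0 M (\<lambda>s. blinfun_apply (z i) (F (B k \<inter> L i) s)) \<le> 0" for k
          using z.zero_iff[of "B k \<inter> L i"] union(3)[of k] E.Int[OF B[of k] \<S>\<E>[OF L_\<S>[of i]]] by simp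
      qed simp
      moreover have "(\<Union>k. B k \<inter> L i) = (\<Union>k. B k) \<inter> L i" by blast
      moreover have "(\<Union>k. B k) \<inter> L i \<in> \<E>" using B \<S>\<E>[OF L_\<S>] by auto
      ultimately show ?case
        using z.zero_iff[of "(\<Union>k. B k) \<inter> L i"]
          mdist0_nonneg[of M "\<lambda>s. blinfun_apply (z i) (F ((\<Union>k. B k) \<inter> L i) s)"] by auto
    qed
  qed
  \<comment> \<open>\<open>G i n - L i\<close> decreases to the empty set, so for some
    \<open>n\<close> all its measurable subsets are small for \<open>w\<close>. An
    \<open>A k\<close> with \<open>k \<ge> n\<close> and \<open>\<tau> k = i\<close> then keeps at
    least \<open>e / 2\<close> inside \<open>L i\<close>.\<close>
  have "\<exists>k. e / 2 \<le> mdist0 M (\<lambda>s. blinfun_apply w (F (A k \<inter> L i) s))" for i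
  proof -
    have "decseq (\<lambda>n. G i n - L i)"
      using G_dec[of i] unfolding decseq_def by blast
    moreover have "range (\<lambda>n. G i n - L i) \<subseteq> \<E>" "(\<Inter>n. G i n - L i) = {}"
      using \<S>\<E>[OF G_\<S>] \<S>\<E>[OF L_\<S>] by (auto simp: L_def)
    ultimately have "\<exists>n. \<forall>B\<in>\<E>. B \<subseteq> G i n - L i \<longrightarrow> mdist0 M (\<lambda>s. blinfun_apply w (F B s)) \<le> e / 2"
      using \<open>0 < e\<close> by (intro w.uniformly_small_tail) auto
    then obtain n where n: "\<And>B. B \<in> \<E> \<Longrightarrow> B \<subseteq> G i n - L i \<Longrightarrow>
        mdist0 M (\<lambda>s. blinfun_apply w (F B s)) \<le> e / 2" by blast
    obtain k where k: "n \<le> k" "\<tau> k = i" using \<tau> by blast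
    then have "A k \<subseteq> G i n"
      unfolding G_def by (auto intro!: exI[of _ "k - n"])
    then have "mdist0 M (\<lambda>s. blinfun_apply w (F (A k - A k \<inter> L i) s)) \<le> e / 2"
      using \<S>\<E>[OF A_\<S>] \<S>\<E>[OF L_\<S>] by (intro n E.Diff E.Int) auto
    moreover have "mdist0 M (\<lambda>s. blinfun_apply w (F (A k) s)) \<le>
        mdist0 M (\<lambda>s. blinfun_apply w (F (A k - A k \<inter> L i) s)) +
        mdist0 M (\<lambda>s. blinfun_apply w (F (A k \<inter> L i) s))"
      using \<S>\<E>[OF A_\<S>] \<S>\<E>[OF L_\<S>] by (intro w.mdist0_le_diff E.Int) auto
    ultimately have "e / 2 \<le> mdist0 M (\<lambda>s. blinfun_apply w (F (A k \<inter> L i) s))"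
      using large[of k] by linarith
    then show ?thesis by blast
  qed
  then obtain k where k: "\<And>i. e / 2 \<le> mdist0 M (\<lambda>s. blinfun_apply w (F (A (k i) \<inter> L i) s))"
    by metis
  define H where "H = (\<lambda>i. A (k i) \<inter> L i)"
  have H_\<S>: "H i \<in> \<S>" for i unfolding H_def using A_\<S> L_\<S> by (intro S.Int)
  \<comment> \<open>Where \<open>z i\<close> and \<open>z j\<close> both give zero, so does their
    difference \<open>(t i - t j) *\<^sub>R w\<close>, and \<open>t\<close> is injective.\<close>
  have meet: "wS.null_on (H i \<inter> H j)" if "i \<noteq> j" for i j
    unfolding wS.null_on_def
  proof (intro conjI ballI impI)
    show "H i \<inter> H j \<in> \<S>" using H_\<S> by blast
    fix B assume B: "B \<in> \<S>" "B \<subseteq> H i \<inter> H j"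
    then have "B \<inter> L i = B" "B \<inter> L j = B" by (auto simp: H_def)
    then have "AE s in M. blinfun_apply (z i) (F B s) = 0" "AE s in M. blinfun_apply (z j) (F B s) = 0"
      using null[OF B(1), of i] null[OF B(1), of j] by simp_all
    then show "AE s in M. blinfun_apply w (F B s) = 0"
    proof eventually_elim
      case (elim s)
      have "(t i - t j) *\<^sub>R blinfun_apply w (F B s) =
          blinfun_apply (z i) (F B s) - blinfun_apply (z j) (F B s)"
        by (simp add: z_def blinfun.add_left blinfun.scaleR_left scaleR_left_diff_distrib)
      then have "(t i - t j) *\<^sub>R blinfun_apply w (F B s) = 0" by (simp add: elim)
      with that \<open>inj t\<close> show ?case by (auto dest: injD)
    qed
  qed
  \<comment> \<open>Making the \<open>H i\<close> disjoint removes only null overlaps. These are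
    known to be null only relative to \<open>\<S>\<close>, hence the use of
    \<open>wS\<close>.\<close>
  have dis: "e / 2 \<le> mdist0 M (\<lambda>s. blinfun_apply w (F (disjointed H i) s))" for i
  proof -
    define N where "N = (\<Union>j. if j < i then H i \<inter> H j else {})"
    have "wS.null_on {}" using wS.empty by (auto simp: wS.null_on_def)
    then have "wS.null_on N"
      unfolding N_def by (intro wS.null_on_UN) (auto intro: meet)
    then have N: "N \<in> \<S>" "mdist0 M (\<lambda>s. blinfun_apply w (F N s)) = 0"
      using wS.zero_iff by (auto simp: wS.null_on_def)
    have "disjointed H i = H i - N"
      by (auto simp: disjointed_def N_def)
    moreover have "N \<subseteq> H i" by (auto simp: N_def split: if_splits)
    ultimately show ?thesis
      using wS.mdist0_le_diff[OF H_\<S>[of i] N(1)] N(2) k[of i]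
      unfolding H_def[THEN fun_cong, of i, symmetric] by simp
  qed
  have "(\<lambda>i. mdist0 M (\<lambda>s. blinfun_apply w (F (disjointed H i) s))) \<longlonglongrightarrow> 0"
    using H_\<S> by (intro wS.exhaustive disjoint_family_disjointed S.range_disjointed_sets) auto
  then have "e / 2 \<le> 0"
    using dis by (intro LIMSEQ_le_const) auto
  with \<open>0 < e\<close> show False by simp
qed

text \<open>Otherwise density near \<open>u\<close> permits an inductive choice that contradicts
  \<open>annihilating_sequence_False\<close>. The centres \<open>c k\<close> converge to
  \<open>a\<close>, while the killing functionals are the shifts
  \<open>c (Suc k) + t (\<tau> k) *\<^sub>R w\<close>.\<close>

lemma kills_nowhere_dense:
  fixes w :: "'a \<Rightarrow>\<^sub>L 'k::banach"
  assumes "subspace X" "w \<in> X" "0 < e" "u \<in> X" "0 < R"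
  shows "\<exists>x\<in>X. \<exists>d>0. dist u x < R \<and> (\<forall>y\<in>X. dist x y < d \<longrightarrow> \<not> kills w e y)"
proof (rule ccontr)
  assume "\<not> ?thesis"
  then have dense: "\<exists>y\<in>X. dist x y < d \<and> kills w e y" if "x \<in> X" "dist u x < R" "0 < d" for x d
    using that by blast
  \<comment> \<open>This bound on \<open>t i\<close> keeps \<open>t i *\<^sub>R w\<close> shorter
    than \<open>R / 2\<close>, so that shifting a centre from the ball of radius
    \<open>R / 2\<close> stays where density is assumed.\<close>
  define q where "q = R / 2 / (1 + norm w)"
  define t where "t = (\<lambda>i::nat. q / Suc i)"
  \<comment> \<open>The first component of the decoded pair takes every value infinitely
    often.\<close>
  define \<tau> where "\<tau> = (\<lambda>k. fst (prod_decode k))"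
  have w1: "0 < 1 + norm w" by (simp add: add_pos_nonneg)
  then have q: "0 < q" using \<open>0 < R\<close> by (simp add: q_def)
  have tw: "norm (t i *\<^sub>R w) < R / 2" for i
  proof -
    have "norm (t i *\<^sub>R w) = t i * norm w" using q by (simp add: t_def)
    also have "\<dots> \<le> q * norm w"
      using q by (intro mult_right_mono) (auto simp: t_def divide_le_eq mult_le_cancel_left1)
    also have "\<dots> < q * (1 + norm w)" using q by simp
    also have "\<dots> = R / 2"
      using nonzero_eq_divide_eq[of "1 + norm w" q "R / 2"] w1 by (simp add: q_def)
    finally show ?thesis .
  qed
  \<comment> \<open>A state consists of a centre, a radius and a finite algebra containing the sets
    found so far. The last clause of \<open>W\<close> makes every later move of the centre
    negligible on \<open>\<T>'\<close>.\<close>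
  define P where "P = (\<lambda>(c, \<rho>, \<T>). c \<in> X \<and> 0 < \<rho> \<and> cball c \<rho> \<subseteq> ball u (R / 2) \<and>
    finite \<T> \<and> algebra \<Omega> \<T> \<and> \<T> \<subseteq> \<E>)"
  define W where "W = (\<lambda>k c \<rho> \<T> c' \<rho>' \<T>' A. A \<in> \<T>' \<and> \<T> \<subseteq> \<T>' \<and> cball c' \<rho>' \<subseteq> cball c \<rho> \<and>
    \<rho>' \<le> (1/2) ^ k \<and> e \<le> mdist0 M (\<lambda>s. blinfun_apply w (F A s)) \<and>
    (\<forall>B\<in>\<E>. B \<subseteq> A \<longrightarrow> (AE s in M. blinfun_apply (c' + t (\<tau> k) *\<^sub>R w) (F B s) = 0)) \<and>
    (\<forall>v :: 'a \<Rightarrow>\<^sub>L 'k. norm v \<le> \<rho>' \<longrightarrow>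
      (\<forall>B\<in>\<T>'. mdist0 M (\<lambda>s. blinfun_apply v (F B s)) \<le> (1/2) ^ k)))"
  define Q where "Q = (\<lambda>k (c, \<rho>, \<T>) (c', \<rho>', \<T>'). \<exists>A. W k c \<rho> \<T> c' \<rho>' \<T>' A)"
  have step: "\<exists>s'. P s' \<and> Q k s s'" if "P s" for k s
  proof -
    obtain c \<rho> \<T> where s: "s = (c, \<rho>, \<T>)" by (cases s)
    with that have c: "c \<in> X" "0 < \<rho>" "cball c \<rho> \<subseteq> ball u (R / 2)"
      and T: "finite \<T>" "algebra \<Omega> \<T>" "\<T> \<subseteq> \<E>" by (auto simp: P_def)
    have "c \<in> ball u (R / 2)" using c by (auto simp: subset_iff)
    then have "dist u (c + t (\<tau> k) *\<^sub>R w) < R"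
      using tw[of "\<tau> k"] dist_triangle[of u "c + t (\<tau> k) *\<^sub>R w" c] by (simp add: dist_norm)
    moreover have "c + t (\<tau> k) *\<^sub>R w \<in> X"
      using assms c by (intro subspace_add subspace_scale)
    ultimately obtain y where y: "y \<in> X" "dist (c + t (\<tau> k) *\<^sub>R w) y < \<rho>" "kills w e y"
      using dense c(2) by blast
    from y(3) obtain A where A: "A \<in> \<E>" "e \<le> mdist0 M (\<lambda>s. blinfun_apply w (F A s))"
      "\<And>B. B \<in> \<E> \<Longrightarrow> B \<subseteq> A \<Longrightarrow> AE s in M. blinfun_apply y (F B s) = 0"
      by (auto simp: kills_def)
    define \<T>' where "\<T>' = algebra_insert \<T> A"
    have T': "algebra \<Omega> \<T>'" "\<T> \<subseteq> \<T>'" "A \<in> \<T>'"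
      unfolding \<T>'_def using algebra_algebra_insert[OF T(2) E.sets_into_space[OF A(1)]] by auto
    have "finite \<T>'" "\<T>' \<subseteq> \<E>"
      using T A(1) by (auto simp: \<T>'_def algebra_insert_def)
    then obtain d where d: "0 < d" "\<And>v :: 'a \<Rightarrow>\<^sub>L 'k. norm v \<le> d \<Longrightarrow>
        \<forall>B\<in>\<T>'. mdist0 M (\<lambda>s. blinfun_apply v (F B s)) \<le> (1/2) ^ k"
      using small_functional_finite[of \<T>' "(1/2) ^ k", where 'k = 'k] by auto
    \<comment> \<open>Undoing the shift lets a single nested sequence of balls serve all indices
      \<open>i\<close>.\<close>
    define c' where "c' = y - t (\<tau> k) *\<^sub>R w"
    \<comment> \<open>The three bounds secure smallness on \<open>\<T>'\<close>, radii tending to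
      zero, and nesting.\<close>
    define \<rho>' where "\<rho>' = min (min d ((1/2) ^ k)) (\<rho> - dist c c')"
    have "dist c c' < \<rho>"
      using y(2) by (simp add: c'_def dist_norm algebra_simps)
    then have \<rho>': "0 < \<rho>'" "\<rho>' \<le> d" "\<rho>' \<le> (1/2) ^ k" "dist c c' + \<rho>' \<le> \<rho>"
      using d(1) by (auto simp: \<rho>'_def)
    have sub: "cball c' \<rho>' \<subseteq> cball c \<rho>"
    proof
      fix x assume "x \<in> cball c' \<rho>'"
      then show "x \<in> cball c \<rho>"
        using dist_triangle[of c x c'] \<rho>'(4) by simp
    qed
    have "P (c', \<rho>', \<T>')"
      using \<rho>' sub c T' \<open>finite \<T>'\<close> \<open>\<T>' \<subseteq> \<E>\<close> y(1) assms(1,2)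
      by (auto simp: P_def c'_def intro: subspace_diff subspace_scale)
    moreover have "Q k s (c', \<rho>', \<T>')"
      unfolding Q_def s W_def prod.case using T' sub \<rho>' A d(2)
      by (intro exI[of _ A]) (auto simp: c'_def)
    ultimately show ?thesis by blast
  qed
  have "P (u, R / 4, {{}, \<Omega>})"
    using assms E.top by (auto simp: P_def algebra_iff_Un subset_iff)
  then obtain f where f: "\<And>k. P (f k)" "\<And>k. Q k (f k) (f (Suc k))"
    using dependent_nat_choice[of "\<lambda>_. P" Q] step by blast
  define c where "c = (\<lambda>k. fst (f k))"
  define \<rho> where "\<rho> = (\<lambda>k. fst (snd (f k)))"
  define \<T> where "\<T> = (\<lambda>k. snd (snd (f k)))"
  have f_eq: "f k = (c k, \<rho> k, \<T> k)" for k by (simp add: c_def \<rho>_def \<T>_def)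
  have P': "0 < \<rho> k" "algebra \<Omega> (\<T> k)" "\<T> k \<subseteq> \<E>" for k
    using f(1)[of k] by (auto simp: P_def f_eq)
  have "\<exists>A. W k (c k) (\<rho> k) (\<T> k) (c (Suc k)) (\<rho> (Suc k)) (\<T> (Suc k)) A" for k
    using f(2)[of k] by (simp add: Q_def f_eq)
  then obtain A where "\<And>k. W k (c k) (\<rho> k) (\<T> k) (c (Suc k)) (\<rho> (Suc k)) (\<T> (Suc k)) (A k)"
    by metis
  note WA = this[unfolded W_def]
  have A: "\<And>k. A k \<in> \<T> (Suc k)" "\<And>k. \<T> k \<subseteq> \<T> (Suc k)"
    "\<And>k. cball (c (Suc k)) (\<rho> (Suc k)) \<subseteq> cball (c k) (\<rho> k)" "\<And>k. \<rho> (Suc k) \<le> (1/2) ^ k"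
    "\<And>k. e \<le> mdist0 M (\<lambda>s. blinfun_apply w (F (A k) s))"
    "\<And>k B. B \<in> \<E> \<Longrightarrow> B \<subseteq> A k \<Longrightarrow> AE s in M. blinfun_apply (c (Suc k) + t (\<tau> k) *\<^sub>R w) (F B s) = 0"
    "\<And>k v B. norm (v :: 'a \<Rightarrow>\<^sub>L 'k) \<le> \<rho> (Suc k) \<Longrightarrow> B \<in> \<T> (Suc k) \<Longrightarrow>
      mdist0 M (\<lambda>s. blinfun_apply v (F B s)) \<le> (1/2) ^ k"
    using WA by blast+
  obtain a where a: "\<And>k. dist (c k) a \<le> \<rho> k"
    using nested_cballs_limit[of c \<rho>] A(3,4) P'(1) by blast
  show False
  proof (rule annihilating_sequence_False[OF _ \<open>0 < e\<close>])
    show "inj t"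
      using q by (intro injI) (auto simp: t_def)
    show "\<exists>k\<ge>n. \<tau> k = i" for i n
      by (intro exI[of _ "prod_encode (i, n)"]) (simp add: \<tau>_def le_prod_encode_2)
    \<comment> \<open>The shifts cancel and leave \<open>a - c (Suc k)\<close>, whose norm is at
      most \<open>\<rho> (Suc k)\<close>.\<close>
    show "mdist0 M (\<lambda>s. blinfun_apply (a + t (\<tau> k) *\<^sub>R w - (c (Suc k) + t (\<tau> k) *\<^sub>R w)) (F B s)) \<le> (1/2) ^ k"
      if "B \<in> \<T> (Suc k)" for k B
      using a[of "Suc k"] that by (intro A(7)) (auto simp: dist_norm norm_minus_commute)
  qed (use A P' in auto)
qed

end

section \<open>Countably many functionals suffice\<close>

context L0_valued_measure
begin

text \<open>Norming functionals for the countably many values of the approximating simple functions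
  suffice, so one null set serves them all. If the functional of \<open>d\<close> annihilates
  \<open>f s\<close>, then \<open>norm d \<le> C * norm (d - f s)\<close>, and \<open>d\<close> can
  be taken arbitrarily close to \<open>f s\<close>.\<close>

lemma AE_zero_if_functionals:
  fixes f :: "'s \<Rightarrow> 'a" and X :: "('a \<Rightarrow>\<^sub>L 'k::real_normed_vector) set"
  assumes norming: "\<And>x. \<exists>v\<in>X. norm v \<le> C \<and> norm x \<le> norm (blinfun_apply v x)" and "0 < C"
    and f: "strongly_measurable M f"
    and zero: "\<And>v. v \<in> X \<Longrightarrow> AE s in M. blinfun_apply v (f s) = 0"
  shows "AE s in M. f s = 0"
proof -
  obtain v where v: "\<And>x. v x \<in> X" "\<And>x. norm (v x) \<le> C" "\<And>x. norm x \<le> norm (blinfun_apply (v x) x)"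
    using norming by metis
  obtain g where g: "\<And>n. simple_function M (g n)" "\<And>s. s \<in> space M \<Longrightarrow> (\<lambda>n. g n s) \<longlonglongrightarrow> f s"
    using f unfolding strongly_measurable_def by auto
  define D where "D = (\<Union>n. g n ` space M)"
  have "countable D"
    unfolding D_def by (intro countable_UN countableI_type countable_finite simple_functionD(1)[OF g(1)])
  then have "AE s in M. \<forall>d\<in>D. blinfun_apply (v d) (f s) = 0"
    using zero v(1) by (simp add: AE_ball_countable)
  moreover have "AE s in M. s \<in> space M" by simp
  ultimately show ?thesis
  proof eventually_elim
    case (elim s)
    have "norm (f s) \<le> (1 + C) * dist (g n s) (f s)" for n
    proof -
      let ?d = "g n s"
      have "?d \<in> D" using elim(2) by (auto simp: D_def)
      then have "blinfun_apply (v ?d) ?d = blinfun_apply (v ?d) (?d - f s)"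
        using elim(1) by (simp add: blinfun.diff_right)
      then have "norm ?d \<le> norm (v ?d) * norm (?d - f s)"
        using v(3)[of ?d] norm_blinfun[of "v ?d" "?d - f s"] by simp
      also have "\<dots> \<le> C * norm (?d - f s)"
        by (intro mult_right_mono v(2)) simp
      finally have "norm ?d \<le> C * norm (?d - f s)" .
      then show ?thesis
        using norm_triangle_sub[of "f s" ?d] by (simp add: dist_norm norm_minus_commute algebra_simps)
    qed
    moreover have "(\<lambda>n. (1 + C) * dist (g n s) (f s)) \<longlonglongrightarrow> 0"
      using g(2)[OF elim(2)] by (intro tendsto_mult_right_zero) (simp add: tendsto_dist_iff[symmetric])
    ultimately have "norm (f s) \<le> 0"
      by (intro LIMSEQ_le_const) auto
    then show ?case by simp
  qed
qed

lemma null_on_Un: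
  assumes "null_on A" "null_on B"
  shows "null_on (A \<union> B)"
  unfolding null_on_def
proof (intro conjI ballI impI)
  have A: "A \<in> \<E>" "B \<in> \<E>" using assms by (auto simp: null_on_def)
  then show "A \<union> B \<in> \<E>" by blast
  fix C assume C: "C \<in> \<E>" "C \<subseteq> A \<union> B"
  have "C \<inter> A \<in> \<E>" "C - A \<in> \<E>" "C - A \<subseteq> B"
    using A C by auto
  then have "AE s in M. F (C \<inter> A) s = 0" "AE s in M. F (C - A) s = 0"
    using assms by (simp_all add: null_on_def)
  moreover have "AE s in M. F ((C \<inter> A) \<union> (C - A)) s = F (C \<inter> A) s + F (C - A) s"
    using A C by (intro additive) auto
  moreover have "(C \<inter> A) \<union> (C - A) = C" by blast
  ultimately show "AE s in M. F C s = 0"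
    by (auto elim: eventually_elim2)
qed

text \<open>The sets with a countable determining family form a \<sigma>-ideal, with a largest
  member \<open>A\<close> modulo null sets. For \<open>B\<close> outside \<open>A\<close> and
  \<open>v\<close> in \<open>X\<close>, let \<open>N\<close> be a largest \<open>v\<close>-null set
  modulo null sets. Then \<open>v\<close> alone determines \<open>B - N\<close>, so
  \<open>B - N\<close> is null by the choice of \<open>A\<close>, and \<open>v\<close> annihilates
  the measure of \<open>B\<close>.\<close>

lemma countable_determining_family:
  fixes X :: "('a \<Rightarrow>\<^sub>L 'k::real_normed_vector) set"
  assumes norming: "\<And>x. \<exists>v\<in>X. norm v \<le> C \<and> norm x \<le> norm (blinfun_apply v x)" and "0 < C"
  obtains w :: "nat \<Rightarrow> 'a \<Rightarrow>\<^sub>L 'k" where "range w \<subseteq> X"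
    "\<And>A. A \<in> \<E> \<Longrightarrow> (\<And>n B. B \<in> \<E> \<Longrightarrow> B \<subseteq> A \<Longrightarrow> AE s in M. blinfun_apply (w n) (F B s) = 0) \<Longrightarrow> null_on A"
proof -
  define null_for where "null_for = (\<lambda>(v :: 'a \<Rightarrow>\<^sub>L 'k) A.
    L0_valued_measure.null_on M \<E> (\<lambda>A s. blinfun_apply v (F A s)) A)"
  note v_measure = L0_valued_measure_blinfun
  have null_for: "null_for v A \<longleftrightarrow> A \<in> \<E> \<and> (\<forall>B\<in>\<E>. B \<subseteq> A \<longrightarrow> (AE s in M. blinfun_apply v (F B s) = 0))" for v A
    unfolding null_for_def by (rule L0_valued_measure.null_on_def[OF v_measure])
  \<comment> \<open>Quantifying over measurable subsets makes the property applicable to each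
    \<open>B \<inter> A i\<close> in the union step.\<close>
  define determines where "determines = (\<lambda>(w :: nat \<Rightarrow> 'a \<Rightarrow>\<^sub>L 'k) A.
    \<forall>B\<in>\<E>. B \<subseteq> A \<longrightarrow> (\<forall>n. null_for (w n) B) \<longrightarrow> null_on B)"
  define \<I> where "\<I> = {A \<in> \<E>. \<exists>w. range w \<subseteq> X \<and> determines w A}"
  obtain v0 where "v0 \<in> X" using norming by blast
  have null_empty: "null_on {}" using empty by (auto simp: null_on_def)
  have \<I>_Union: "(\<Union>i. A i) \<in> \<I>" if "range A \<subseteq> \<I>" for A :: "nat \<Rightarrow> 'e set"
  proof -
    have "\<forall>i. \<exists>w. range w \<subseteq> X \<and> determines w (A i)" and A: "A i \<in> \<E>" for i
      using that by (auto simp: \<I>_def)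
    then obtain W where W: "\<And>i. range (W i) \<subseteq> X" "\<And>i. determines (W i) (A i)" by metis
    \<comment> \<open>The pairing of natural numbers merges the sequences \<open>W i\<close> into
      one.\<close>
    define w where "w = (\<lambda>k. W (fst (prod_decode k)) (snd (prod_decode k)))"
    have "determines w (\<Union>i. A i)"
      unfolding determines_def
    proof (intro ballI impI)
      fix B assume B: "B \<in> \<E>" "B \<subseteq> (\<Union>i. A i)" "\<forall>n. null_for (w n) B"
      have "null_on (B \<inter> A i)" for i
      proof -
        have "null_for (W i n) (B \<inter> A i)" for n
        proof -
          have "null_for (W i n) B"
            using B(3)[rule_format, of "prod_encode (i, n)"] by (simp add: w_def)
          then show ?thesis using A[of i] by (auto simp: null_for)
        qed
        then show ?thesis
          using W(2)[of i] E.Int[OF B(1) A[of i]] by (simp add: determines_def)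
      qed
      then have "null_on (\<Union>i. B \<inter> A i)" by (rule null_on_UN)
      moreover have "(\<Union>i. B \<inter> A i) = B" using B(2) by blast
      ultimately show "null_on B" by simp
    qed
    moreover have "range w \<subseteq> X" using W(1) by (auto simp: w_def)
    ultimately show ?thesis using A by (auto simp: \<I>_def)
  qed
  have "{} \<in> \<I>"
    using \<open>v0 \<in> X\<close> null_empty by (auto simp: \<I>_def determines_def intro!: exI[of _ "\<lambda>_. v0"])
  then obtain A where A: "A \<in> \<I>" "\<And>B. B \<in> \<I> \<Longrightarrow> null_on (B - A)"
    using ex_largest_mod_null[OF _ _ \<I>_Union] by (auto simp: \<I>_def)
  obtain w where w: "range w \<subseteq> X" "determines w A" and A_\<E>: "A \<in> \<E>"
    using A(1) by (auto simp: \<I>_def)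
  have rest: "null_on (\<Omega> - A)"
    unfolding null_on_def
  proof (intro conjI ballI impI)
    show "\<Omega> - A \<in> \<E>" using A_\<E> by blast
    fix B assume B: "B \<in> \<E>" "B \<subseteq> \<Omega> - A"
    show "AE s in M. F B s = 0"
    proof (rule AE_zero_if_functionals[OF norming \<open>0 < C\<close> meas[OF B(1)]])
      fix v assume v: "v \<in> X"
      interpret v: L0_valued_measure M \<Omega> \<E> "\<lambda>A s. blinfun_apply v (F A s)"
        by (rule v_measure)
      have "Collect (null_for v) \<subseteq> \<E>"
        by (auto simp: null_for)
      moreover have "{} \<in> Collect (null_for v)"
        using v.empty by (auto simp: null_for)
      moreover have "(\<Union>i. N i) \<in> Collect (null_for v)" if "range N \<subseteq> Collect (null_for v)"
        for N :: "nat \<Rightarrow> 'e set"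
        using that v.null_on_UN[of N] by (auto simp: null_for_def)
      ultimately obtain N where N: "null_for v N" "\<And>D. null_for v D \<Longrightarrow> null_on (D - N)"
        using ex_largest_mod_null[of "Collect (null_for v)"] by (metis mem_Collect_eq)
      have N_\<E>: "N \<in> \<E>" using N(1) by (simp add: null_for)
      \<comment> \<open>A \<open>v\<close>-null subset \<open>D\<close> of \<open>B - N\<close>
        equals \<open>D - N\<close>, which is null by the choice of \<open>N\<close>.\<close>
      have "determines (\<lambda>_. v) (B - N)"
        unfolding determines_def
      proof (intro ballI impI)
        fix D assume "D \<subseteq> B - N" "\<forall>n :: nat. null_for v D"
        then show "null_on D" using N(2)[of D] by (simp add: Diff_triv disjoint_iff subset_iff)
      qed
      then have "B - N \<in> \<I>"
        using v B(1) N_\<E> by (auto simp: \<I>_def)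
      then have "null_on (B - N - A)" by (rule A(2))
      moreover have "B - N - A = B - N" using B(2) by blast
      ultimately have "AE s in M. F (B - N) s = 0"
        by (auto simp: null_on_def)
      moreover have "AE s in M. blinfun_apply v (F (B \<inter> N) s) = 0"
        using N(1) B(1) N_\<E> by (auto simp: null_for)
      moreover have "AE s in M. F ((B - N) \<union> (B \<inter> N)) s = F (B - N) s + F (B \<inter> N) s"
        using B(1) N_\<E> by (intro additive) auto
      ultimately show "AE s in M. blinfun_apply v (F B s) = 0"
        by eventually_elim (simp add: Un_Diff_Int blinfun.add_right)
    qed
  qed
  show thesis
  proof (rule that[OF w(1)])
    fix B assume B: "B \<in> \<E>"
      and zero: "\<And>n D. D \<in> \<E> \<Longrightarrow> D \<subseteq> B \<Longrightarrow> AE s in M. blinfun_apply (w n) (F D s) = 0"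
    have BA: "B \<inter> A \<in> \<E>" using B A_\<E> by (rule E.Int)
    then have "null_for (w n) (B \<inter> A)" for n
      using zero by (auto simp: null_for)
    then have "null_on (B \<inter> A)"
      using w(2) BA by (simp add: determines_def)
    moreover have "null_on (B - A)"
      using rest B A_\<E> E.sets_into_space[OF B] by (intro null_on_subset[OF rest]) auto
    ultimately have "null_on ((B \<inter> A) \<union> (B - A))" by (rule null_on_Un)
    moreover have "(B \<inter> A) \<union> (B - A) = B" by blast
    ultimately show "null_on B" by simp
  qed
qed

text \<open>Baire category in the closed subspace \<open>X\<close>: a functional outside the
  countably many nowhere dense sets \<open>K (n, j)\<close> annihilates no set on which some
  \<open>w n\<close> gives a nonzero value.\<close>

lemma ex_determining_functional:
  fixes X :: "('a \<Rightarrow>\<^sub>L 'k::banach) set"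
  assumes norming: "\<And>x. \<exists>v\<in>X. norm v \<le> C \<and> norm x \<le> norm (blinfun_apply v x)" and "0 < C"
    and X: "subspace X" "closed X"
  shows "\<exists>z\<in>X. \<forall>A\<in>\<E>. (\<forall>B\<in>\<E>. B \<subseteq> A \<longrightarrow> (AE s in M. blinfun_apply z (F B s) = 0)) \<longrightarrow> null_on A"
proof -
  obtain w :: "nat \<Rightarrow> 'a \<Rightarrow>\<^sub>L 'k" where w: "range w \<subseteq> X"
    "\<And>A. A \<in> \<E> \<Longrightarrow> (\<And>n B. B \<in> \<E> \<Longrightarrow> B \<subseteq> A \<Longrightarrow> AE s in M. blinfun_apply (w n) (F B s) = 0) \<Longrightarrow> null_on A"
    using countable_determining_family[OF norming \<open>0 < C\<close>] by blast
  define K where "K = (\<lambda>(n, j). X \<inter> closure {z \<in> X. kills (w n) (1 / Suc j) z})"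
  have "(top_of_set X) interior_of \<Union>(range K) = {}"
  proof (rule Baire_category_alt)
    show "completely_metrizable_space (top_of_set X) \<or>
        locally_compact_space (top_of_set X) \<and> regular_space (top_of_set X)"
      using completely_metrizable_space_closedin[OF completely_metrizable_space_euclidean, of X] X(2)
      by simp
    fix T assume "T \<in> range K"
    then obtain n j where T: "T = X \<inter> closure {z \<in> X. kills (w n) (1 / Suc j) z}"
      by (auto simp: K_def)
    have "(top_of_set X) interior_of T = {}"
    proof (rule ccontr)
      assume "(top_of_set X) interior_of T \<noteq> {}"
      then obtain U u where "openin (top_of_set X) U" "U \<subseteq> T" "u \<in> U"
        by (auto simp: interior_of_def)
      then obtain R where R: "0 < R" "\<And>x. x \<in> X \<Longrightarrow> dist u x < R \<Longrightarrow> x \<in> T" and "u \<in> X"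
        unfolding openin_euclidean_subtopology_iff by (metis dist_commute subset_eq)
      have "w n \<in> X" using w(1) by blast
      then obtain x d where x: "x \<in> X" "0 < d" "dist u x < R"
        "\<And>y. y \<in> X \<Longrightarrow> dist x y < d \<Longrightarrow> \<not> kills (w n) (1 / Suc j) y"
        using kills_nowhere_dense[OF X(1) _ _ \<open>u \<in> X\<close> R(1), of "w n" "1 / Suc j"] by auto
      have "x \<in> closure {z \<in> X. kills (w n) (1 / Suc j) z}"
        using R(2)[OF x(1,3)] T by blast
      then show False
        using x(2,4) by (auto simp: closure_approachable dist_commute)
    qed
    then show "closedin (top_of_set X) T \<and> (top_of_set X) interior_of T = {}"
      by (simp add: T closedin_closed_Int)
  qed auto
  moreover have "X \<noteq> {}" using subspace_0[OF X(1)] by blast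
  ultimately have "\<not> X \<subseteq> \<Union>(range K)"
    by (metis Int_absorb1 interior_of_eq_empty interior_of_topspace topspace_euclidean_subtopology
        interior_of_mono subset_empty)
  then obtain z where z: "z \<in> X" "z \<notin> \<Union>(range K)" by blast
  have not_kills: "\<not> kills (w n) (1 / Suc j) z" for n j
  proof
    assume "kills (w n) (1 / Suc j) z"
    then have "z \<in> K (n, j)"
      using z(1) closure_subset[of "{z \<in> X. kills (w n) (1 / Suc j) z}"] by (auto simp: K_def)
    with z(2) show False by blast
  qed
  show ?thesis
  proof (intro bexI[OF _ z(1)] ballI impI)
    fix A assume A: "A \<in> \<E>"
      and zero: "\<forall>B\<in>\<E>. B \<subseteq> A \<longrightarrow> (AE s in M. blinfun_apply z (F B s) = 0)"
    show "null_on A"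
    proof (rule w(2)[OF A], rule ccontr)
      fix n B
      assume B: "B \<in> \<E>" "B \<subseteq> A" and "\<not> (AE s in M. blinfun_apply (w n) (F B s) = 0)"
      then have "mdist0 M (\<lambda>s. blinfun_apply (w n) (F B s)) > 0"
        using mdist0_eq_0_iff[OF strongly_measurable_blinfun[OF meas[OF B(1)]], of "w n"]
          mdist0_nonneg[of M "\<lambda>s. blinfun_apply (w n) (F B s)"] by linarith
      \<comment> \<open>A positive size exceeds some \<open>1 / Suc j\<close>, which places
        \<open>z\<close> in one of the excluded sets.\<close>
      then obtain j where "1 / Suc j < mdist0 M (\<lambda>s. blinfun_apply (w n) (F B s))"
        using nat_approx_posE by blast
      then have "kills (w n) (1 / Suc j) z"
        unfolding kills_def using B zero by (intro bexI[of _ B]) auto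
      with not_kills show False by blast
    qed
  qed
qed

end

section \<open>Measures with values in classes of functions\<close>

text \<open>With strongly measurable representatives, sums and differences of classes become those
  of functions, and convergence in \<open>fnorm\<close> gives convergence in
  \<open>mdist0\<close>.\<close>

lemma L0_representation:
  fixes m :: "'e set \<Rightarrow> ('s \<Rightarrow> 'a::real_normed_vector) set"
  assumes "finite_measure M" "sigma_algebra \<Omega> \<E>" "L0_vector_measure \<E> M m"
  obtains F where "L0_valued_measure M \<Omega> \<E> F" "\<And>A. A \<in> \<E> \<Longrightarrow> m A = L0_class M (F A)"
proof -
  interpret finite_measure M by fact
  interpret E: sigma_algebra \<Omega> \<E> by fact
  have "\<exists>f. strongly_measurable M f \<and> m A = L0_class M f" if "A \<in> \<E>" for A
  proof -
    have "m A \<in> L0 M" using assms(3) that by (auto simp: L0_vector_measure_def)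
    then obtain f where f: "bochner_measurable M f" "m A = L0_class M f" by (auto simp: L0_def)
    then obtain f' where "strongly_measurable M f'" "AE s in M. f s = f' s"
      using bochner_measurable_strong_representative by blast
    with f(2) L0_class_cong show ?thesis by blast
  qed
  then obtain F where F: "\<And>A. A \<in> \<E> \<Longrightarrow> strongly_measurable M (F A)" "\<And>A. A \<in> \<E> \<Longrightarrow> m A = L0_class M (F A)"
    by metis
  have "(\<lambda>n. mdist0 M (\<lambda>s. (\<Sum>i<n. F (A i) s) - F (\<Union>i. A i) s)) \<longlonglongrightarrow> 0"
    if A: "range A \<subseteq> \<E>" "disjoint_family A" for A :: "nat \<Rightarrow> 'e set"
  proof (rule mdist0_tendsto_0_if_fnorm)
    have U: "(\<Union>i. A i) \<in> \<E>" using A(1) by blast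
    have A': "A i \<in> \<E>" for i using A(1) by blast
    have sum: "strongly_measurable M (\<lambda>s. \<Sum>i<n. F (A i) s)" for n
      by (intro strongly_measurable_sum F A')
    show "strongly_measurable M (\<lambda>s. (\<Sum>i<n. F (A i) s) - F (\<Union>i. A i) s)" for n
      by (intro strongly_measurable_diff sum F U)
    have partial: "L0_partial_sum M (\<lambda>i. m (A i)) n = L0_class M (\<lambda>s. \<Sum>i<n. F (A i) s)" for n
    proof (induct n)
      case (Suc n)
      then show ?case
        using L0_plus_class[of M "\<lambda>s. \<Sum>i<n. F (A i) s" "F (A n)"]
        by (simp add: F(2)[OF A'] strongly_measurable_imp_bochner sum F(1)[OF A'])
    qed (simp add: L0_zero_def)
    have "L0_norm M (L0_minus M (L0_partial_sum M (\<lambda>i. m (A i)) n) (m (\<Union>i. A i))) =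
        fnorm M (\<lambda>s. (\<Sum>i<n. F (A i) s) - F (\<Union>i. A i) s)" for n
      unfolding partial F(2)[OF U]
      by (subst L0_minus_class)
        (auto intro!: L0_norm_class strongly_measurable_imp_bochner sum F U)
    moreover have "L0_sums M (\<lambda>i. m (A i)) (m (\<Union>i. A i))"
      using assms(3) A by (simp add: L0_vector_measure_def)
    ultimately show "(\<lambda>n. fnorm M (\<lambda>s. (\<Sum>i<n. F (A i) s) - F (\<Union>i. A i) s)) \<longlonglongrightarrow> 0"
      by (simp add: L0_sums_def)
  qed
  then have "L0_valued_measure M \<Omega> \<E> F"
    by unfold_locales (rule F(1))
  with F(2) that show thesis by blast
qed

theorem theorem3p6:
  fixes M :: "'s measure"
    and \<Omega> :: "'e set" and \<E> :: "'e set set"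
    and scl :: "'k::{real_normed_field,euclidean_space} \<Rightarrow> 'z::banach \<Rightarrow> 'z"
    and m :: "'e set \<Rightarrow> ('s \<Rightarrow> 'z) set"
  assumes "finite_measure M"
    and "sigma_algebra \<Omega> \<E>"
    and "banach_space_over scl"
    and "L0_vector_measure \<E> M m"
  shows "\<exists>z0\<in>dual_ball scl.
    L0_abs_cont \<E> M m (functional_measure M z0 m) \<and>
    (\<forall>\<nu>. control_measure \<Omega> \<E> M (functional_measure M z0 m) \<nu> \<longrightarrow> control_measure \<Omega> \<E> M m \<nu>)"
proof -
  obtain F where F: "L0_valued_measure M \<Omega> \<E> F" "\<And>A. A \<in> \<E> \<Longrightarrow> m A = L0_class M (F A)"
    using L0_representation[OF assms(1,2,4)] by blast
  interpret F: L0_valued_measure M \<Omega> \<E> F by (rule F(1))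
  obtain C where C: "0 < C"
    "\<And>x. \<exists>v\<in>dual_space scl. norm v \<le> C \<and> norm x \<le> norm (blinfun_apply v x)"
    using banach_space_over.dual_space_norming[OF assms(3)] by blast
  obtain z where z: "z \<in> dual_space scl"
    "\<And>A. A \<in> \<E> \<Longrightarrow> \<forall>B\<in>\<E>. B \<subseteq> A \<longrightarrow> (AE s in M. blinfun_apply z (F B s) = 0) \<Longrightarrow> F.null_on A"
    using F.ex_determining_functional[OF C(2,1) subspace_dual_space closed_dual_space] by blast
  \<comment> \<open>Rescaling does not affect vanishing, and \<open>1 + norm z\<close> is positive
    even for \<open>z = 0\<close>.\<close>
  define z0 where "z0 = inverse (1 + norm z) *\<^sub>R z"
  have pos: "0 < 1 + norm z" by (simp add: add_pos_nonneg)
  then have "norm z0 \<le> 1" by (simp add: z0_def divide_simps)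
  moreover have "z0 \<in> dual_space scl"
    unfolding z0_def by (rule subspace_scale[OF subspace_dual_space z(1)])
  ultimately have z0: "z0 \<in> dual_ball scl" by (simp add: dual_ball_def)
  have bochner: "bochner_measurable M (F A)" if "A \<in> \<E>" for A
    by (intro strongly_measurable_imp_bochner F.meas that)
  have zero: "m A = L0_zero M \<longleftrightarrow> (AE s in M. F A s = 0)" if "A \<in> \<E>" for A
    using L0_class_eq_iff[OF bochner[OF that] bochner_measurable_zero]
    by (simp add: F(2)[OF that] L0_zero_def)
  have z0_zero: "functional_measure M z0 m A = L0_zero M \<longleftrightarrow> (AE s in M. blinfun_apply z (F A s) = 0)"
    if "A \<in> \<E>" for A
  proof -
    have "functional_measure M z0 m A = L0_class M (\<lambda>s. blinfun_apply z0 (F A s))"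
      by (simp add: functional_measure_def F(2)[OF that] L0_comp_class bochner[OF that])
    moreover have "bochner_measurable M (\<lambda>s. blinfun_apply z0 (F A s))"
      by (intro strongly_measurable_imp_bochner strongly_measurable_blinfun F.meas that)
    ultimately have "functional_measure M z0 m A = L0_zero M \<longleftrightarrow>
        (AE s in M. blinfun_apply z0 (F A s) = 0)"
      by (simp add: L0_zero_def L0_class_eq_iff bochner_measurable_zero)
    then show ?thesis
      using pos by (simp add: z0_def blinfun.scaleR_left)
  qed
  have ac: "L0_abs_cont \<E> M m (functional_measure M z0 m)"
    unfolding L0_abs_cont_def
  proof (intro ballI impI)
    fix A B
    assume A: "A \<in> \<E>" "\<forall>B\<in>\<E>. B \<subseteq> A \<longrightarrow> functional_measure M z0 m B = L0_zero M" and B: "B \<in> \<E>" "B \<subseteq> A"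
    have "F.null_on A"
      using A by (intro z(2)) (auto simp: z0_zero)
    with B show "m B = L0_zero M" by (simp add: zero F.null_on_def)
  qed
  \<comment> \<open>A null set of a positive measure has only null measurable subsets, so the
    hypothesis of absolute continuity holds on all of them.\<close>
  have "control_measure \<Omega> \<E> M m \<nu>" if \<nu>: "control_measure \<Omega> \<E> M (functional_measure M z0 m) \<nu>" for \<nu>
  proof -
    have "m A = L0_zero M" if A: "A \<in> \<E>" "emeasure \<nu> A = 0" for A
    proof -
      have "functional_measure M z0 m B = L0_zero M" if "B \<in> \<E>" "B \<subseteq> A" for B
      proof -
        have "emeasure \<nu> B = 0"
          using emeasure_mono[OF that(2), of \<nu>] A \<nu> by (simp add: control_measure_def)
        then show ?thesis using \<nu> that(1) by (simp add: control_measure_def)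
      qed
      with ac A(1) show ?thesis by (auto simp: L0_abs_cont_def)
    qed
    with \<nu> show ?thesis by (simp add: control_measure_def)
  qed
  with z0 ac show ?thesis by blast
qed

end
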